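(* There do not exist a finite set of labeled terminals $P=\{x_1,\dots,x_n\}\subset\mathbb{R}^2$ and two distinct topologies $T_1\neq T_2$ such that both locally minimal trees $S_{T_1}(P)$ (with topology $T_1$) and $S_{T_2}(P)$ (with topology $T_2$) for $P$ exist and are codirected at terminals, i.e. such that for some $\varepsilon>0$ \[ S_{T_1}(P)\cap B_\varepsilon(P)=S_{T_2}(P)\cap B_\varepsilon(P), \] where $B_\varepsilon(P)$ is the open $\varepsilon$-neighborhood of $P$.
   Context: A Steiner tree for a finite set $Q\subset\mathbb{R}^2$ is a connected set containing $Q$ of minimal one-dimensional Hausdorff measure among all connected sets containing $Q$. For a finite set $P\subset\mathbb{R}^2$ (the terminals), a locally minimal tree for $P$ is a connected acyclic set $S\supset P$, which is a finite union of closed straight line segments, such that for every point $x\in S$ and all small enough $\varepsilon>0$ the closure $\overline{S\cap B_\varepsilon(x)}$ is a Steiner tree for the finite set $(\{x\}\cap P)\cup(S\cap\partial B_\varepsilon(x))$, where $B_\varepsilon(x)$ is the open disc of radius $\varepsilon$ centered at $x$. Acyclic means that $S$ contains no closed loop (no subset homeomorphic to a circle). Such an $S$ is represented as a tree embedded in the plane with straight-line edges. Its vertices are the terminals together with the points of $S\setminus P$ at which three segments of $S$ meet; the latter are called Steiner points. All vertices have degree at most $3$, every Steiner point has degree $3$, and any two edges sharing an endpoint make an angle of at least $2\pi/3$. The topology of a locally minimal tree is the corresponding abstract graph with labeled terminals and unlabeled Steiner points; two topologies are equal if there is a graph isomorphism between them preserving the labels of the terminals. For every topology $T$ and every $P$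 there is at most one locally minimal tree for $P$ with topology $T$ (Melzak); it is denoted by $S_T(P)$ when it exists. *)

theory Defs
  imports "HOL-Analysis.Analysis"
begin

text \<open>Covering sets are required to be bounded because \<^const>\<open>diameter\<close> is meaningless otherwise.
  Finite covers are included, since the empty set has diameter 0. In dimension one the usual
  normalising constant is 1, so that a segment has measure equal to its length.\<close>

definition hausdorff_content1 :: "real \<Rightarrow> 'a::metric_space set \<Rightarrow> ennreal" where
  "hausdorff_content1 \<delta> A =
     (INF U \<in> {U :: nat \<Rightarrow> 'a set. A \<subseteq> (\<Union>i. U i) \<and> (\<forall>i. bounded (U i) \<and> diameter (U i) \<le> \<delta>)}.
        \<Sum>i. ennreal (diameter (U i)))"

definition hausdorff_measure1 :: "'a::metric_space set \<Rightarrow> ennreal" where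
  "hausdorff_measure1 A = (SUP \<delta> \<in> {0<..}. hausdorff_content1 \<delta> A)"

definition steiner_tree :: "(real^2) set \<Rightarrow> (real^2) set \<Rightarrow> bool" where
  "steiner_tree Q S \<longleftrightarrow>
     finite Q \<and> connected S \<and> Q \<subseteq> S \<and>
     (\<forall>S'. connected S' \<and> Q \<subseteq> S' \<longrightarrow> hausdorff_measure1 S \<le> hausdorff_measure1 S')"

definition no_closed_loop :: "(real^2) set \<Rightarrow> bool" where
  "no_closed_loop S \<longleftrightarrow> \<not> (\<exists>C \<subseteq> S. C homeomorphic sphere (0 :: real^2) 1)"

definition finite_union_of_segments :: "(real^2) set \<Rightarrow> bool" where
  "finite_union_of_segments S \<longleftrightarrow>
     (\<exists>F. finite F \<and> S = (\<Union>(a, b) \<in> F. closed_segment a b))"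

definition locally_minimal_tree :: "(real^2) set \<Rightarrow> (real^2) set \<Rightarrow> bool" where
  "locally_minimal_tree P S \<longleftrightarrow>
     finite P \<and> P \<subseteq> S \<and> connected S \<and> no_closed_loop S \<and> finite_union_of_segments S \<and>
     (\<forall>x \<in> S. \<forall>\<^sub>F \<epsilon> in at_right 0.
        steiner_tree (({x} \<inter> P) \<union> (S \<inter> sphere x \<epsilon>)) (closure (S \<inter> ball x \<epsilon>)))"

text \<open>An abstract graph with labelled terminals: the terminal with label \<open>i\<close> is the \<open>i\<close>-th entry
  of the list \<open>terms\<close>. The vertices not occurring in that list are the unlabelled Steiner points.\<close>

record 'v lgraph =
  verts :: "'v set"
  adj :: "'v \<Rightarrow> 'v \<Rightarrow> bool"
  terms :: "'v list"

definition labelled_graph :: "'v lgraph \<Rightarrow> bool" where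
  "labelled_graph G \<longleftrightarrow>
     finite (verts G) \<and> distinct (terms G) \<and> set (terms G) \<subseteq> verts G \<and>
     (\<forall>u v. adj G u v \<longrightarrow> u \<in> verts G \<and> v \<in> verts G \<and> u \<noteq> v \<and> adj G v u)"

definition lgraph_iso :: "'v lgraph \<Rightarrow> 'w lgraph \<Rightarrow> bool" (infix "\<cong>\<^sub>L" 50) where
  "G \<cong>\<^sub>L H \<longleftrightarrow>
     (\<exists>f. bij_betw f (verts G) (verts H) \<and>
          (\<forall>u \<in> verts G. \<forall>v \<in> verts G. adj G u v \<longleftrightarrow> adj H (f u) (f v)) \<and>
          map f (terms G) = terms H)"

text \<open>Requiring the three segments to overlap only in \<open>x\<close> means that they leave \<open>x\<close> in three
  different directions.\<close>

definition steiner_points :: "(real^2) set \<Rightarrow> (real^2) set \<Rightarrow> (real^2) set" where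
  "steiner_points P S =
     {x \<in> S - P. \<exists>a b c. a \<noteq> x \<and> b \<noteq> x \<and> c \<noteq> x \<and>
        closed_segment x a \<subseteq> S \<and> closed_segment x b \<subseteq> S \<and> closed_segment x c \<subseteq> S \<and>
        closed_segment x a \<inter> closed_segment x b = {x} \<and>
        closed_segment x a \<inter> closed_segment x c = {x} \<and>
        closed_segment x b \<inter> closed_segment x c = {x}}"

definition tree_vertices :: "(real^2) set \<Rightarrow> (real^2) set \<Rightarrow> (real^2) set" where
  "tree_vertices P S = P \<union> steiner_points P S"

definition tree_graph :: "(real^2) list \<Rightarrow> (real^2) set \<Rightarrow> (real^2) lgraph" where
  "tree_graph xs S =
     (let V = tree_vertices (set xs) S in
      \<lparr> verts = V,
        adj = (\<lambda>u v. u \<in> V \<and> v \<in> V \<and> u \<noteq> v \<and>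
                     closed_segment u v \<subseteq> S \<and> open_segment u v \<inter> V = {}),
        terms = xs \<rparr>)"

text \<open>Every finite labelled graph is isomorphic to one whose vertices are natural numbers, and
  topologies are only considered up to \<open>\<cong>\<^sub>L\<close>.\<close>

type_synonym topology = "nat lgraph"

text \<open>The following says that \<open>S\<close> is (the) locally minimal tree \<open>S\<^sub>T(P)\<close> with topology \<open>T\<close>, where
  \<open>P\<close> is the set of terminals listed, in the order of their labels, in \<open>xs\<close>.\<close>

definition locally_minimal_tree_of :: "topology \<Rightarrow> (real^2) list \<Rightarrow> (real^2) set \<Rightarrow> bool" where
  "locally_minimal_tree_of T xs S \<longleftrightarrow>
     labelled_graph T \<and> locally_minimal_tree (set xs) S \<and> tree_graph xs S \<cong>\<^sub>L T"

definition codirected_at :: "(real^2) set \<Rightarrow> (real^2) set \<Rightarrow> (real^2) set \<Rightarrow> bool" where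
  "codirected_at P S1 S2 \<longleftrightarrow>
     (\<exists>\<epsilon> > 0. S1 \<inter> (\<Union>p \<in> P. ball p \<epsilon>) = S2 \<inter> (\<Union>p \<in> P. ball p \<epsilon>))"

end

theory Submission
  imports Defs
begin

text \<open>A tree is reduced to the set of directions in which edges leave each of its points. Away from the
  terminals local minimality makes this set balanced: it is empty, or two opposite directions, or three
  directions with sum zero (\<open>locally_minimal_tree_balanced\<close>). At a terminal nothing is known, but there
  codirected trees have the same directions. The theorem follows from the statement that two acyclic
  networks which at every point are either both balanced or equal in direction have the same
  directions everywhere (\<open>networks_same_directions\<close>), because the topology can be read off from the
  segments that the network contains.

  Suppose a direction \<open>u\<close> occurs at some point in a network \<open>A\<close> but not in \<open>B\<close>. Only the edges whose
  direction is a multiple of 60 degrees away from \<open>u\<close> are kept. This does not disturb the balance, since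
  a balanced set of directions lies inside this class of six directions or avoids it. Edges of \<open>A\<close> are
  counted with weight 1 and edges of \<open>B\<close> with weight \<open>-1\<close>, so that common edges, and with them all
  terminals, disappear. A balanced system of unit tensions is the system of creases of a continuous
  function that is linear between the edges, the Airy stress function of the system. Here it has
  convex creases along \<open>A\<close> and concave ones along \<open>B\<close>, and it vanishes far away.

  The six directions span a lattice, so in suitable coordinates all slopes of the stress function are
  integers. If its maximum is positive, consider the plateau \<open>M\<close> where it is attained. At a point of
  \<open>M\<close> outside \<open>B\<close> all creases are convex, so the function is constant nearby. At any point of \<open>M\<close> the
  six slopes are integers \<open>\<le> 0\<close>, and integrality forces two neighbouring ones to vanish
  (\<open>adjacent_flat_slopes\<close>); so \<open>M\<close> contains an open sector. Thus \<open>M - B\<close> is nonempty, open, and closed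
  in the complement of \<open>B\<close>, without being all of it: the network \<open>B\<close> separates the plane. By
  Janiszewski's theorem an acyclic union of segments does not
  (\<open>acyclic_segments_nonseparating\<close>). So the stress function is nowhere positive, by symmetry nowhere
  negative, and the excess of \<open>A\<close> over \<open>B\<close> vanishes.\<close>

section \<open>Length of straight networks\<close>

text \<open>Finitely many sets suffice to bound the measure of a network of segments from above, and finite
  lists of sets can simply be concatenated.\<close>
definition thinly_coverable :: "real \<Rightarrow> 'a::metric_space set \<Rightarrow> real \<Rightarrow> bool" where
  "thinly_coverable \<delta> A c \<longleftrightarrow>
     (\<exists>Us. A \<subseteq> \<Union>(set Us) \<and> (\<forall>U\<in>set Us. bounded U \<and> diameter U \<le> \<delta>) \<and> (\<Sum>U\<leftarrow>Us. diameter U) \<le> c)"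

lemma thinly_coverable_Un:
  assumes "thinly_coverable \<delta> A c" "thinly_coverable \<delta> B d"
  shows "thinly_coverable \<delta> (A \<union> B) (c + d)"
proof -
  obtain Us Vs where
    "A \<subseteq> \<Union>(set Us)" "\<forall>U\<in>set Us. bounded U \<and> diameter U \<le> \<delta>" "(\<Sum>U\<leftarrow>Us. diameter U) \<le> c"
    "B \<subseteq> \<Union>(set Vs)" "\<forall>U\<in>set Vs. bounded U \<and> diameter U \<le> \<delta>" "(\<Sum>U\<leftarrow>Vs. diameter U) \<le> d"
    using assms unfolding thinly_coverable_def by blast
  then show ?thesis unfolding thinly_coverable_def by (intro exI[of _ "Us @ Vs"]) auto
qed

lemma hausdorff_content1_le:
  assumes "thinly_coverable \<delta> A c" "0 \<le> \<delta>"
  shows "hausdorff_content1 \<delta> A \<le> ennreal c"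
proof -
  obtain Us where Us: "A \<subseteq> \<Union>(set Us)" "\<And>U. U \<in> set Us \<Longrightarrow> bounded U \<and> diameter U \<le> \<delta>"
    "(\<Sum>U\<leftarrow>Us. diameter U) \<le> c"
    using assms unfolding thinly_coverable_def by blast
  define W where "W i = (if i < length Us then Us ! i else {})" for i
  have "A \<subseteq> (\<Union>i. W i)" using Us(1) by (force simp: W_def in_set_conv_nth)
  moreover have "bounded (W i) \<and> diameter (W i) \<le> \<delta>" for i
    using Us(2) assms(2) by (simp add: W_def)
  ultimately have "hausdorff_content1 \<delta> A \<le> (\<Sum>i. ennreal (diameter (W i)))"
    unfolding hausdorff_content1_def by (intro INF_lower) auto
  also have "\<dots> = (\<Sum>i<length Us. ennreal (diameter (W i)))"
    by (rule suminf_finite) (auto simp: W_def)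
  also have "\<dots> = ennreal (\<Sum>i<length Us. diameter (Us ! i))"
    by (subst sum_ennreal) (use Us(2) in \<open>auto simp: W_def intro: diameter_ge_0\<close>)
  also have "(\<Sum>i<length Us. diameter (Us ! i)) = (\<Sum>U\<leftarrow>Us. diameter U)"
    by (simp add: sum_list_sum_nth atLeast0LessThan)
  also have "ennreal \<dots> \<le> ennreal c" using Us(3) by (rule ennreal_leI)
  finally show ?thesis .
qed

lemma thinly_coverable_segment:
  fixes a b :: "'a::euclidean_space"
  assumes "0 < \<delta>"
  shows "thinly_coverable \<delta> (closed_segment a b) (dist a b)"
proof -
  obtain n :: nat where n: "dist a b / \<delta> < n" using reals_Archimedean2 by blast
  have "0 \<le> dist a b / \<delta>" using assms by simp
  then have n0: "0 < real n" using n by linarith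
  define p where "p i = a + (real i / real n) *\<^sub>R (b - a)" for i :: nat
  define U where "U i = closed_segment (p i) (p (Suc i))" for i
  have step: "p (Suc i) - p i = (1 / real n) *\<^sub>R (b - a)" for i
    by (simp add: p_def add_divide_distrib flip: scaleR_diff_left)
  have diam: "diameter (U i) \<le> dist a b / n" for i
  proof (rule diameter_le)
    fix x y assume "x \<in> U i" "y \<in> U i"
    then obtain s t where st: "0 \<le> s" "s \<le> 1" "0 \<le> t" "t \<le> 1"
      "x = p i + s *\<^sub>R (p (Suc i) - p i)" "y = p i + t *\<^sub>R (p (Suc i) - p i)"
      by (auto simp: U_def closed_segment_def algebra_simps)
    have "x - y = (s - t) *\<^sub>R (p (Suc i) - p i)" unfolding st(5,6) by (simp add: scaleR_diff_left)
    then have "norm (x - y) = \<bar>s - t\<bar> * (dist a b / n)"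
      using n0 by (simp add: step dist_norm norm_minus_commute)
    also have "\<dots> \<le> 1 * (dist a b / n)" using st(1-4) n0 by (intro mult_right_mono) auto
    finally show "norm (x - y) \<le> dist a b / n" by simp
  qed (use n0 in simp)
  have small: "dist a b / n \<le> \<delta>" using n n0 assms by (simp add: field_simps)
  have "closed_segment a b \<subseteq> (\<Union>i<n. U i)"
  proof
    fix x assume "x \<in> closed_segment a b"
    then obtain t where t: "0 \<le> t" "t \<le> 1" "x = a + t *\<^sub>R (b - a)"
      by (auto simp: closed_segment_def algebra_simps)
    define i where "i = (if t = 1 then n - 1 else nat \<lfloor>t * n\<rfloor>)"
    have i: "i < n" "real i \<le> t * n" "t * n \<le> real (Suc i)"
    proof -
      have "t * n < n" if "t \<noteq> 1" using t(2) that n0 by simp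
      then show "i < n" using n0 t(1) by (auto simp: i_def) (simp add: floor_less_iff nat_less_iff)
      show "real i \<le> t * n" using n0 t(1) by (auto simp: i_def)
      show "t * n \<le> real (Suc i)" using n0 t(1) by (auto simp: i_def of_nat_diff) linarith
    qed
    have "x = p i + (t * n - i) *\<^sub>R (p (Suc i) - p i)"
    proof -
      have "(t * n - i) * (1 / real n) = t - i / n" using n0 by (simp add: field_simps)
      then have "(t * n - i) *\<^sub>R (p (Suc i) - p i) = (t - i / n) *\<^sub>R (b - a)"
        unfolding step by (metis scaleR_scaleR)
      then show ?thesis by (simp add: t(3) p_def algebra_simps)
    qed
    then have "x \<in> U i" unfolding U_def closed_segment_def
      using i by (intro CollectI exI[of _ "t * n - i"]) (auto simp: algebra_simps)
    then show "x \<in> (\<Union>i<n. U i)" using i(1) by auto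
  qed
  moreover have "(\<Sum>V\<leftarrow>map U [0..<n]. diameter V) \<le> dist a b"
  proof -
    have "(\<Sum>V\<leftarrow>map U [0..<n]. diameter V) = (\<Sum>i<n. diameter (U i))"
      by (simp add: comp_def interv_sum_list_conv_sum_set_nat atLeast0LessThan)
    also have "\<dots> \<le> (\<Sum>i<n. dist a b / n)" by (rule sum_mono) (rule diam)
    finally show ?thesis using n0 by simp
  qed
  moreover have "bounded V \<and> diameter V \<le> \<delta>" if "V \<in> set (map U [0..<n])" for V
    using that order_trans[OF diam small] by (auto simp: U_def intro: compact_imp_bounded)
  ultimately show ?thesis
    unfolding thinly_coverable_def by (intro exI[of _ "map U [0..<n]"]) (auto simp: atLeast0LessThan)
qed

lemma hausdorff_measure1_segments_le:
  fixes es :: "('a::euclidean_space \<times> 'a) list"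
  shows "hausdorff_measure1 (\<Union>(a, b)\<in>set es. closed_segment a b) \<le> ennreal (\<Sum>(a, b)\<leftarrow>es. dist a b)"
  unfolding hausdorff_measure1_def
proof (rule SUP_least)
  fix \<delta> :: real assume "\<delta> \<in> {0<..}"
  then have "0 < \<delta>" by simp
  have "thinly_coverable \<delta> (\<Union>(a, b)\<in>set es. closed_segment a b) (\<Sum>(a, b)\<leftarrow>es. dist a b)"
  proof (induction es)
    case Nil
    then show ?case unfolding thinly_coverable_def by (intro exI[of _ "[]"]) auto
  next
    case (Cons e es)
    then show ?case
      using thinly_coverable_Un[OF thinly_coverable_segment[OF \<open>0 < \<delta>\<close>, of "fst e" "snd e"] Cons]
      by (simp add: case_prod_beta)
  qed
  then show "hausdorff_content1 \<delta> (\<Union>(a, b)\<in>set es. closed_segment a b) \<le> ennreal (\<Sum>(a, b)\<leftarrow>es. dist a b)"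
    using \<open>0 < \<delta>\<close> by (intro hausdorff_content1_le) auto
qed

lemma hausdorff_measure1_mono:
  assumes "A \<subseteq> B"
  shows "hausdorff_measure1 A \<le> hausdorff_measure1 B"
  unfolding hausdorff_measure1_def hausdorff_content1_def
  by (intro SUP_mono' INF_superset_mono) (use assms in auto)

text \<open>Away from their common end the spokes have positive distance, so a set of small diameter meets
  at most one of them. Projecting each spoke to its own line turns the cover into one cover of an
  interval for each spoke, and no set is counted twice.\<close>
lemma hausdorff_content1_spokes_ge:
  fixes x :: "'a::euclidean_space" and \<epsilon> :: real
  assumes "finite U" "\<And>u. u \<in> U \<Longrightarrow> norm u = 1" "0 < \<eta>" "\<eta> < \<epsilon>"
    and sep: "\<And>u v y z. u \<in> U \<Longrightarrow> v \<in> U \<Longrightarrow> u \<noteq> v \<Longrightarrow> y \<in> closed_segment (x + \<eta> *\<^sub>R u) (x + \<epsilon> *\<^sub>R u) \<Longrightarrow>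
        z \<in> closed_segment (x + \<eta> *\<^sub>R v) (x + \<epsilon> *\<^sub>R v) \<Longrightarrow> \<delta> < dist y z"
  shows "ennreal (real (card U) * (\<epsilon> - \<eta>)) \<le> hausdorff_content1 \<delta> (\<Union>u\<in>U. closed_segment x (x + \<epsilon> *\<^sub>R u))"
  unfolding hausdorff_content1_def
proof (rule INF_greatest, clarify)
  fix W :: "nat \<Rightarrow> 'a set"
  assume cover: "(\<Union>u\<in>U. closed_segment x (x + \<epsilon> *\<^sub>R u)) \<subseteq> (\<Union>i. W i)"
    and W: "\<forall>i. bounded (W i) \<and> diameter (W i) \<le> \<delta>"
  define T where "T u = closed_segment (x + \<eta> *\<^sub>R u) (x + \<epsilon> *\<^sub>R u)" for u
  define A where "A u i = (\<lambda>y. (y - x) \<bullet> u) ` (W i \<inter> T u)" for u i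
  \<comment> \<open>the case distinction is needed because \<open>Inf\<close> and \<open>Sup\<close> of the empty set are unspecified\<close>
  define J where "J u i = (if A u i = {} then {} else {Inf (A u i)..Sup (A u i)})" for u i
  have bdd: "s - t \<le> diameter (W i)" if st: "u \<in> U" "s \<in> A u i" "t \<in> A u i" for u i s t
  proof -
    obtain y z where yz: "y \<in> W i" "z \<in> W i" "s = (y - x) \<bullet> u" "t = (z - x) \<bullet> u"
      using st(2,3) unfolding A_def by blast
    have "s - t = (y - z) \<bullet> u" by (simp add: yz inner_diff_left)
    also have "\<dots> \<le> dist y z" using norm_cauchy_schwarz[of "y - z" u] assms(2)[OF st(1)] by (simp add: dist_norm)
    also have "\<dots> \<le> diameter (W i)" using W yz by (intro diameter_bounded_bound) auto
    finally show ?thesis .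
  qed
  have bddb: "bdd_above (A u i)" "bdd_below (A u i)" if "u \<in> U" for u i
  proof -
    have "bdd_above (A u i) \<and> bdd_below (A u i)"
    proof (cases "A u i = {}")
      case False
      then obtain t where t: "t \<in> A u i" by blast
      have "bdd_above (A u i)"
        by (rule bdd_aboveI[of _ "t + diameter (W i)"]) (use bdd[OF that _ t] in force)
      moreover have "bdd_below (A u i)"
        by (rule bdd_belowI[of _ "t - diameter (W i)"]) (use bdd[OF that t] in force)
      ultimately show ?thesis by blast
    qed simp
    then show "bdd_above (A u i)" "bdd_below (A u i)" by auto
  qed
  have J_le: "emeasure lborel (J u i) \<le> ennreal (diameter (W i))" if "u \<in> U" for u i
  proof (cases "A u i = {}")
    case False
    have "Sup (A u i) \<le> Inf (A u i) + diameter (W i)"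
    proof (rule cSup_least[OF False])
      fix s assume s: "s \<in> A u i"
      have "s - diameter (W i) \<le> Inf (A u i)"
        by (rule cInf_greatest[OF False]) (use bdd[OF that s] in force)
      then show "s \<le> Inf (A u i) + diameter (W i)" by simp
    qed
    moreover have "Inf (A u i) \<le> Sup (A u i)"
      using False bddb[OF that] by (metis cInf_le_cSup)
    ultimately show ?thesis using False by (simp add: J_def ennreal_leI)
  qed (simp add: J_def)
  have T_sub: "T u \<subseteq> closed_segment x (x + \<epsilon> *\<^sub>R u)" for u
  proof -
    have "x + \<eta> *\<^sub>R u \<in> closed_segment x (x + \<epsilon> *\<^sub>R u)"
      unfolding closed_segment_def using assms(3,4)
      by (intro CollectI exI[of _ "\<eta> / \<epsilon>"]) (auto simp: algebra_simps)
    then show ?thesis by (simp add: T_def closed_segment_subset)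
  qed
  have spoke: "ennreal (\<epsilon> - \<eta>) \<le> (\<Sum>i. emeasure lborel (J u i))" if u: "u \<in> U" for u
  proof -
    have "{\<eta>..\<epsilon>} \<subseteq> (\<Union>i. J u i)"
    proof
      fix t assume t: "t \<in> {\<eta>..\<epsilon>}"
      define y where "y = x + t *\<^sub>R u"
      have "y \<in> T u"
      proof -
        define k where "k = (t - \<eta>) / (\<epsilon> - \<eta>)"
        have k: "0 \<le> k" "k \<le> 1" "k * (\<epsilon> - \<eta>) = t - \<eta>" using t assms(4) by (auto simp: k_def)
        have "y = x + (\<eta> + k * (\<epsilon> - \<eta>)) *\<^sub>R u" by (simp add: y_def k(3))
        also have "\<dots> = (1 - k) *\<^sub>R (x + \<eta> *\<^sub>R u) + k *\<^sub>R (x + \<epsilon> *\<^sub>R u)" by (simp add: algebra_simps)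
        finally show ?thesis using k(1,2) unfolding T_def closed_segment_def by blast
      qed
      moreover obtain i where "y \<in> W i" using \<open>y \<in> T u\<close> T_sub[of u] cover u by blast
      moreover have "(y - x) \<bullet> u = t" using assms(2)[OF u] by (simp add: y_def dot_square_norm)
      ultimately have "t \<in> A u i" by (force simp: A_def)
      then have "t \<in> J u i" using bddb[OF u] by (auto simp: J_def intro: cInf_lower cSup_upper)
      then show "t \<in> (\<Union>i. J u i)" by blast
    qed
    then have "emeasure lborel {\<eta>..\<epsilon>} \<le> emeasure lborel (\<Union>i. J u i)"
      by (rule emeasure_mono) (auto simp: J_def)
    also have "\<dots> \<le> (\<Sum>i. emeasure lborel (J u i))"
      by (rule emeasure_subadditive_countably) (auto simp: J_def)
    finally show ?thesis using assms(4) by simp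
  qed
  have thin: "(\<Sum>u\<in>U. emeasure lborel (J u i)) \<le> ennreal (diameter (W i))" for i
  proof (cases "\<exists>u\<in>U. A u i \<noteq> {}")
    case True
    then obtain u where u: "u \<in> U" "A u i \<noteq> {}" by blast
    have "J v i = {}" if "v \<in> U - {u}" for v
    proof (rule ccontr)
      assume "J v i \<noteq> {}"
      then have "A v i \<noteq> {}" by (auto simp: J_def)
      then obtain y z where "y \<in> W i" "y \<in> T u" "z \<in> W i" "z \<in> T v" using u(2) by (auto simp: A_def)
      then have "\<delta> < dist y z" "dist y z \<le> \<delta>"
        using sep[of u v y z] u(1) that W diameter_bounded_bound[of "W i" y z] by (auto simp: T_def intro: order_trans)
      then show False by simp
    qed
    then have "(\<Sum>u\<in>U. emeasure lborel (J u i)) = emeasure lborel (J u i)"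
      using assms(1) u(1) by (subst sum.remove[of U u]) auto
    then show ?thesis using J_le[OF u(1)] by simp
  next
    case False
    then show ?thesis by (simp add: J_def)
  qed
  have "ennreal (real (card U) * (\<epsilon> - \<eta>)) = (\<Sum>u\<in>U. ennreal (\<epsilon> - \<eta>))"
    using assms(4) by (simp add: ennreal_mult ennreal_of_nat_eq_real_of_nat)
  also have "\<dots> \<le> (\<Sum>u\<in>U. \<Sum>i. emeasure lborel (J u i))" by (rule sum_mono) (rule spoke)
  also have "\<dots> = (\<Sum>i. \<Sum>u\<in>U. emeasure lborel (J u i))" by (rule suminf_sum[symmetric]) simp
  also have "\<dots> \<le> (\<Sum>i. ennreal (diameter (W i)))" by (rule suminf_le) (auto simp: thin)
  finally show "ennreal (real (card U) * (\<epsilon> - \<eta>)) \<le> (\<Sum>i. ennreal (diameter (W i)))" .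
qed

text \<open>The previous bound applies to the spokes shortened by any \<open>\<eta>\<close> at the hub; \<open>\<eta>\<close> then tends to 0.\<close>
lemma hausdorff_measure1_spokes_ge:
  fixes x :: "'a::euclidean_space" and \<epsilon> :: real
  assumes "finite U" "\<And>u. u \<in> U \<Longrightarrow> norm u = 1" "0 < \<epsilon>"
  shows "ennreal (real (card U) * \<epsilon>) \<le> hausdorff_measure1 (\<Union>u\<in>U. closed_segment x (x + \<epsilon> *\<^sub>R u))"
proof -
  let ?X = "\<Union>u\<in>U. closed_segment x (x + \<epsilon> *\<^sub>R u)"
  have trimmed: "ennreal (real (card U) * (\<epsilon> - \<eta>)) \<le> hausdorff_measure1 ?X" if \<eta>: "0 < \<eta>" "\<eta> < \<epsilon>" for \<eta>
  proof -
    let ?T = "\<lambda>u. closed_segment (x + \<eta> *\<^sub>R u) (x + \<epsilon> *\<^sub>R u)"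
    have "\<exists>d>0. \<forall>y\<in>?T u. \<forall>z\<in>?T v. d \<le> dist y z" if "u \<in> U" "v \<in> U" "u \<noteq> v" for u v
    proof (rule separate_compact_closed)
      show "?T u \<inter> ?T v = {}"
      proof (rule ccontr)
        assume "?T u \<inter> ?T v \<noteq> {}"
        then obtain s t where st: "0 \<le> s" "0 \<le> t" "s \<le> 1" "t \<le> 1"
          "(1 - s) *\<^sub>R (x + \<eta> *\<^sub>R u) + s *\<^sub>R (x + \<epsilon> *\<^sub>R u) = (1 - t) *\<^sub>R (x + \<eta> *\<^sub>R v) + t *\<^sub>R (x + \<epsilon> *\<^sub>R v)"
          by (force simp: closed_segment_def)
        define a where "a = \<eta> + s * (\<epsilon> - \<eta>)"
        define b where "b = \<eta> + t * (\<epsilon> - \<eta>)"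
        have ab: "0 < a" "0 < b" using st \<eta> by (auto simp: a_def b_def intro: add_pos_nonneg)
        have "a *\<^sub>R u = b *\<^sub>R v" using st(5) by (simp add: a_def b_def algebra_simps)
        moreover from this have "a = b" using ab assms(2)[OF that(1)] assms(2)[OF that(2)]
          by (metis abs_of_pos mult.right_neutral norm_scaleR)
        ultimately show False using ab that(3) by simp
      qed
    qed auto
    then obtain d where d: "\<And>u v. u \<in> U \<Longrightarrow> v \<in> U \<Longrightarrow> u \<noteq> v \<Longrightarrow> 0 < d u v \<and> (\<forall>y\<in>?T u. \<forall>z\<in>?T v. d u v \<le> dist y z)"
      by metis
    define \<delta> where "\<delta> = Min (insert 1 ((\<lambda>(u, v). d u v) ` {(u, v) \<in> U \<times> U. u \<noteq> v})) / 2"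
    have fin: "finite ((\<lambda>(u, v). d u v) ` {(u, v) \<in> U \<times> U. u \<noteq> v})"
      by (intro finite_imageI finite_subset[OF _ finite_cartesian_product[OF assms(1) assms(1)]]) auto
    have \<delta>: "0 < \<delta>" using fin d by (auto simp: \<delta>_def)
    have "2 * \<delta> \<le> d u v" if "u \<in> U" "v \<in> U" "u \<noteq> v" for u v
      using fin that by (auto simp: \<delta>_def intro!: Min_le)
    then have "\<delta> < d u v" if "u \<in> U" "v \<in> U" "u \<noteq> v" for u v
      using that \<delta> by (smt (verit))
    then have "ennreal (real (card U) * (\<epsilon> - \<eta>)) \<le> hausdorff_content1 \<delta> ?X"
      using \<eta> d assms(1,2) by (intro hausdorff_content1_spokes_ge) (auto, meson less_le_trans)
    also have "\<dots> \<le> hausdorff_measure1 ?X"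
      unfolding hausdorff_measure1_def using \<delta> by (intro SUP_upper) auto
    finally show ?thesis .
  qed
  show ?thesis
  proof (cases "hausdorff_measure1 ?X")
    case (real h)
    have "real (card U) * \<epsilon> \<le> h"
    proof (rule field_le_epsilon)
      fix e :: real assume e: "0 < e"
      define \<eta> where "\<eta> = min (\<epsilon> / 2) (e / (card U + 1))"
      have \<eta>: "0 < \<eta>" "\<eta> < \<epsilon>" using assms(3) e by (auto simp: \<eta>_def)
      have "real (card U) * \<eta> \<le> (card U + 1) * (e / (card U + 1))"
        using e \<eta>(1) by (intro mult_mono) (auto simp: \<eta>_def)
      then have "real (card U) * \<eta> \<le> e" by simp
      moreover have "real (card U) * (\<epsilon> - \<eta>) \<le> h" using trimmed[OF \<eta>] real \<eta>(2) by (simp add: ennreal_le_iff)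
      ultimately show "real (card U) * \<epsilon> \<le> h + e" by (simp add: algebra_simps)
    qed
    then show ?thesis using real by (simp add: ennreal_leI)
  qed simp
qed

section \<open>Edge directions at a point of a network\<close>

definition directions :: "'a::real_normed_vector set \<Rightarrow> 'a \<Rightarrow> 'a set" where
  "directions S x = {u. norm u = 1 \<and> (\<exists>t>0. closed_segment x (x + t *\<^sub>R u) \<subseteq> S)}"

text \<open>Within this radius the network is the union of the rays given by its directions.\<close>
definition star_radius :: "'a::real_normed_vector set \<Rightarrow> 'a \<Rightarrow> real \<Rightarrow> bool" where
  "star_radius S x r \<longleftrightarrow> 0 < r \<and> (\<forall>y. y \<noteq> x \<longrightarrow> dist x y < r \<longrightarrow> (y \<in> S \<longleftrightarrow> sgn (y - x) \<in> directions S x))"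

lemma directions_outside: "x \<notin> S \<Longrightarrow> directions S x = {}"
  by (auto simp: directions_def)

lemma sgn_ray:
  fixes u :: "'a::real_normed_vector"
  assumes "norm u = 1" "0 < t"
  shows "sgn (t *\<^sub>R u) = u"
  using assms by (simp add: sgn_div_norm)

lemma segment_star:
  fixes a b x :: "'a::euclidean_space"
  shows "\<exists>r>0. \<exists>D. finite D \<and> (\<forall>y. y \<noteq> x \<longrightarrow> dist x y < r \<longrightarrow> (y \<in> closed_segment a b \<longleftrightarrow> sgn (y - x) \<in> D))"
proof (cases "x \<in> closed_segment a b")
  case False
  then obtain r where "0 < r" "ball x r \<subseteq> - closed_segment a b"
    by (meson ComplI closed_segment open_Compl openE)
  then show ?thesis by (intro exI[of _ r] conjI exI[of _ "{}"]) auto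
next
  case True
  define D where "D = (\<lambda>c. sgn (c - x)) ` ({a, b} - {x})"
  define r where "r = Min (insert 1 ((\<lambda>c. dist x c) ` ({a, b} - {x})))"
  have un: "closed_segment x a \<union> closed_segment x b = closed_segment a b"
    using Un_closed_segment[OF True] by (simp add: closed_segment_commute)
  have r: "0 < r" "\<And>c. c \<in> {a, b} - {x} \<Longrightarrow> r \<le> dist x c" by (auto simp: r_def)
  have "y \<in> closed_segment a b \<longleftrightarrow> sgn (y - x) \<in> D" if y: "y \<noteq> x" "dist x y < r" for y
  proof
    assume "y \<in> closed_segment a b"
    then obtain c where c: "c \<in> {a, b}" "y \<in> closed_segment x c" using un by auto
    then obtain s where s: "0 \<le> s" "y - x = s *\<^sub>R (c - x)"
      by (auto simp: closed_segment_def algebra_simps)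
    then have "s \<noteq> 0" "c \<noteq> x" using y(1) by auto
    then show "sgn (y - x) \<in> D" using s c(1) by (auto simp: D_def sgn_scaleR)
  next
    assume "sgn (y - x) \<in> D"
    then obtain c where c: "c \<in> {a, b} - {x}" "sgn (y - x) = sgn (c - x)" by (auto simp: D_def)
    define s where "s = norm (y - x) / norm (c - x)"
    have s: "0 \<le> s" "s \<le> 1" using r(2)[OF c(1)] y c(1) by (auto simp: s_def dist_norm norm_minus_commute divide_simps)
    have "y - x = norm (y - x) *\<^sub>R sgn (y - x)" by (simp add: sgn_div_norm y(1))
    also have "\<dots> = s *\<^sub>R (c - x)" unfolding c(2) by (simp add: s_def sgn_div_norm field_simps)
    finally have "y = (1 - s) *\<^sub>R x + s *\<^sub>R c" by (simp add: algebra_simps)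
    then have "y \<in> closed_segment x c" using s by (auto simp: closed_segment_def)
    then show "y \<in> closed_segment a b" using c(1) un by auto
  qed
  moreover have "finite D" by (simp add: D_def)
  ultimately show ?thesis using r(1) by blast
qed

lemma segments_star:
  fixes x :: "'a::euclidean_space"
  assumes "finite F"
  shows "\<exists>r>0. \<exists>D. finite D \<and> (\<forall>y. y \<noteq> x \<longrightarrow> dist x y < r \<longrightarrow>
           (y \<in> (\<Union>(a, b)\<in>F. closed_segment a b) \<longleftrightarrow> sgn (y - x) \<in> D))"
  using assms
proof (induction F rule: finite_induct)
  case empty
  show ?case by (intro exI[of _ 1] conjI exI[of _ "{}"]) auto
next
  case (insert e F)
  obtain a b where e: "e = (a, b)" by (cases e)
  obtain r D where 1: "0 < r" "finite D" "\<And>y. y \<noteq> x \<Longrightarrow> dist x y < r \<Longrightarrow>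
           (y \<in> (\<Union>(a, b)\<in>F. closed_segment a b) \<longleftrightarrow> sgn (y - x) \<in> D)"
    using insert.IH by blast
  obtain r' D' where 2: "0 < r'" "finite D'" "\<And>y. y \<noteq> x \<Longrightarrow> dist x y < r' \<Longrightarrow>
           (y \<in> closed_segment a b \<longleftrightarrow> sgn (y - x) \<in> D')"
    using segment_star by blast
  show ?case
    using 1 2 by (intro exI[of _ "min r r'"] conjI exI[of _ "D \<union> D'"]) (auto simp: e)
qed

lemma star_radius_exists:
  fixes S :: "(real^2) set"
  assumes "finite_union_of_segments S"
  shows "\<exists>r. star_radius S x r" "finite (directions S x)"
proof -
  obtain F where F: "finite F" "S = (\<Union>(a, b)\<in>F. closed_segment a b)"
    using assms by (auto simp: finite_union_of_segments_def)
  have clo: "closed S" unfolding F(2) using F(1) by (intro closed_UN) auto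
  obtain r D where r: "0 < r" "finite D" "\<And>y. y \<noteq> x \<Longrightarrow> dist x y < r \<Longrightarrow> (y \<in> S \<longleftrightarrow> sgn (y - x) \<in> D)"
    using segments_star[OF F(1), of x] unfolding F(2) by blast
  have eq: "u \<in> D \<longleftrightarrow> u \<in> directions S x" if u: "norm u = 1" for u
  proof -
    have near: "x + t *\<^sub>R u \<in> S \<longleftrightarrow> u \<in> D" if "0 < t" "t < r" for t
    proof -
      have "u \<noteq> 0" using u by auto
      then show ?thesis using r(3)[of "x + t *\<^sub>R u"] that u sgn_ray[OF u that(1)] by (simp add: dist_norm)
    qed
    show ?thesis
    proof
      assume uD: "u \<in> D"
      have sub: "open_segment x (x + (r / 2) *\<^sub>R u) \<subseteq> S"
      proof
        fix y assume "y \<in> open_segment x (x + (r / 2) *\<^sub>R u)"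
        then obtain s where "0 < s" "s < 1" "y = x + (s * (r / 2)) *\<^sub>R u"
          by (auto simp: in_segment algebra_simps)
        moreover from this have "0 < s * (r / 2)" "s * (r / 2) < 1 * r"
          using r(1) by (auto intro!: mult_strict_mono)
        ultimately show "y \<in> S" using near[of "s * (r / 2)"] uD by auto
      qed
      have "closed_segment x (x + (r / 2) *\<^sub>R u) = closure (open_segment x (x + (r / 2) *\<^sub>R u))"
        using r(1) u by auto
      also have "\<dots> \<subseteq> S" using sub clo by (rule closure_minimal)
      finally show "u \<in> directions S x" using u r(1) unfolding directions_def
        by (intro CollectI conjI exI[of _ "r / 2"]) auto
    next
      assume "u \<in> directions S x"
      then obtain t where t: "0 < t" "closed_segment x (x + t *\<^sub>R u) \<subseteq> S" by (auto simp: directions_def)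
      define m where "m = min t (r / 2)"
      have m: "0 < m" "m < r" "m \<le> t" using t(1) r(1) by (auto simp: m_def)
      have "x + m *\<^sub>R u \<in> closed_segment x (x + t *\<^sub>R u)"
        unfolding closed_segment_def using m t(1)
        by (intro CollectI exI[of _ "m / t"]) (auto simp: algebra_simps)
      then show "u \<in> D" using near[OF m(1,2)] t(2) by blast
    qed
  qed
  have "directions S x \<subseteq> D" using eq by (auto simp: directions_def)
  then show "finite (directions S x)" using r(2) finite_subset by blast
  have "star_radius S x r"
    unfolding star_radius_def using r(1,3) eq by (simp add: norm_sgn)
  then show "\<exists>r. star_radius S x r" ..
qed

lemma star_radius_ray:
  assumes "star_radius S x r" "norm u = 1" "0 < t" "t < r"
  shows "x + t *\<^sub>R u \<in> S \<longleftrightarrow> u \<in> directions S x"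
proof -
  have "x + t *\<^sub>R u \<noteq> x" "dist x (x + t *\<^sub>R u) < r" using assms by (auto simp: dist_norm)
  then show ?thesis using assms(1) sgn_ray[OF assms(2,3)] unfolding star_radius_def by (metis add_diff_cancel_left')
qed

text \<open>A direction \<open>v\<close> at a point of the ray yields points of the network that tend to that point, seen
  from \<open>x\<close> under angles that tend to \<open>u\<close>. As only finitely many rays leave \<open>x\<close>, these points are on the
  ray itself, so \<open>v\<close> is parallel to it.\<close>
lemma directions_on_ray:
  fixes S :: "(real^2) set"
  assumes star: "star_radius S x r" and fin: "finite (directions S x)"
    and u: "u \<in> directions S x" and t: "0 < t" "t < r"
  shows "directions S (x + t *\<^sub>R u) = {u, - u}"
proof
  let ?y = "x + t *\<^sub>R u" and ?D = "directions S x"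
  have nu: "norm u = 1" using u by (simp add: directions_def)
  show "directions S ?y \<subseteq> {u, - u}"
  proof
    fix v assume "v \<in> directions S ?y"
    then obtain e where v: "norm v = 1" "0 < e" "closed_segment ?y (?y + e *\<^sub>R v) \<subseteq> S"
      by (auto simp: directions_def)
    have "((\<lambda>s. sgn (t *\<^sub>R u + s *\<^sub>R v)) \<longlongrightarrow> sgn (t *\<^sub>R u + 0 *\<^sub>R v)) (at_right 0)"
      using t nu by (intro tendsto_intros) auto
    then have "((\<lambda>s. sgn (t *\<^sub>R u + s *\<^sub>R v)) \<longlongrightarrow> u) (at_right 0)"
      using sgn_ray[OF nu t(1)] by simp
    moreover have "open (- (?D - {u}))"
      by (intro open_Compl finite_imp_closed finite_Diff fin)
    ultimately have "\<forall>\<^sub>F s in at_right 0. sgn (t *\<^sub>R u + s *\<^sub>R v) \<in> - (?D - {u})"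
      by (auto dest: topological_tendstoD)
    moreover have "\<forall>\<^sub>F s in at_right 0. s < min e (min t (r - t))"
    proof -
      have "0 < min e (min t (r - t))" using v(2) t by simp
      then show ?thesis unfolding eventually_at_right_field by blast
    qed
    moreover have "\<forall>\<^sub>F s in at_right (0::real). 0 < s" by (rule eventually_at_right_less)
    ultimately have "\<forall>\<^sub>F s in at_right 0. 0 < s \<and> s < min e (min t (r - t)) \<and> sgn (t *\<^sub>R u + s *\<^sub>R v) \<in> - (?D - {u})"
      by eventually_elim auto
    then obtain s where s: "0 < s" "s < e" "s < t" "s < r - t" "sgn (t *\<^sub>R u + s *\<^sub>R v) \<notin> ?D - {u}"
      using eventually_happens'[of "at_right (0::real)"] by (auto simp: trivial_limit_at_right_real)
    let ?w = "t *\<^sub>R u + s *\<^sub>R v"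
    have "?y + s *\<^sub>R v \<in> closed_segment ?y (?y + e *\<^sub>R v)"
      unfolding closed_segment_def using s v(2) by (intro CollectI exI[of _ "s / e"]) (auto simp: algebra_simps)
    then have "x + ?w \<in> S" using v(3) by (auto simp: algebra_simps)
    moreover have "norm ?w < r" using norm_triangle_ineq[of "t *\<^sub>R u" "s *\<^sub>R v"] nu v(1) s t by simp
    moreover have nz: "?w \<noteq> 0"
    proof
      assume "?w = 0"
      then have "norm (t *\<^sub>R u) = norm (s *\<^sub>R v)" by (metis add_eq_0_iff norm_minus_cancel)
      then show False using nu v(1) s t by simp
    qed
    moreover have "dist x (x + ?w) = norm ?w" by (metis add_diff_cancel_left' dist_commute dist_norm)
    ultimately have "x + ?w \<noteq> x" "dist x (x + ?w) < r" "x + ?w \<in> S" by simp_all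
    then have "sgn ?w \<in> ?D" using star unfolding star_radius_def by (metis add_diff_cancel_left')
    then have "sgn ?w = u" using s(5) by blast
    then have "?w = norm ?w *\<^sub>R u" using nz by (metis divideR_right norm_eq_zero sgn_div_norm)
    then have sv: "s *\<^sub>R v = (norm ?w - t) *\<^sub>R u" by (simp add: algebra_simps)
    then have "s = \<bar>norm ?w - t\<bar>" using nu v(1) s(1) by (metis abs_of_pos mult.right_neutral norm_scaleR)
    then have "norm ?w - t = s \<or> norm ?w - t = - s" by linarith
    then have "s *\<^sub>R v = s *\<^sub>R u \<or> s *\<^sub>R v = s *\<^sub>R (- u)" using sv by (metis scaleR_minus_left scaleR_minus_right)
    then show "v \<in> {u, - u}" using s(1) by (simp only: scaleR_cancel_left) simp
  qed
  have inS: "x + s *\<^sub>R u \<in> S" if "0 < s" "s < r" for s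
    using star_radius_ray[OF star nu that] u by simp
  define e where "e = min t (r - t) / 2"
  have e: "0 < e" "e < t" "e < r - t" using t by (auto simp: e_def)
  have "closed_segment ?y (?y + e *\<^sub>R (c *\<^sub>R u)) \<subseteq> S" if c: "\<bar>c\<bar> = 1" for c :: real
  proof
    fix z assume "z \<in> closed_segment ?y (?y + e *\<^sub>R (c *\<^sub>R u))"
    then obtain k where k: "0 \<le> k" "k \<le> 1" "z = x + (t + k * e * c) *\<^sub>R u"
      by (auto simp: closed_segment_def algebra_simps)
    have "\<bar>k * e * c\<bar> \<le> e" using k c e(1) by (simp add: abs_mult mult_left_le_one_le)
    then show "z \<in> S" using inS[of "t + k * e * c"] e k(3) by auto
  qed
  from this[of 1] this[of "- 1"] show "{u, - u} \<subseteq> directions S ?y"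
    using e(1) nu by (auto simp: directions_def intro!: exI[of _ e])
qed

lemma directions_off_rays:
  assumes "star_radius S x r" "y \<noteq> x" "dist x y < r" "sgn (y - x) \<notin> directions S x"
  shows "directions S y = {}"
  using assms by (intro directions_outside) (auto simp: star_radius_def)

section \<open>Steiner minimality forces balance\<close>

text \<open>Minimality enters the proof through this inequality. Competitors are networks of segments, because a
  trivial cover bounds their measure.\<close>
lemma steiner_tree_spokes_le:
  fixes x :: "real^2" and \<epsilon> :: real
  assumes "steiner_tree ((\<lambda>u. x + \<epsilon> *\<^sub>R u) ` U) C" "(\<Union>u\<in>U. closed_segment x (x + \<epsilon> *\<^sub>R u)) \<subseteq> C"
    and "finite U" "\<And>u. u \<in> U \<Longrightarrow> norm u = 1" "0 < \<epsilon>"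
    and "connected (\<Union>(a, b)\<in>set es. closed_segment a b)"
    and "(\<lambda>u. x + \<epsilon> *\<^sub>R u) ` U \<subseteq> (\<Union>(a, b)\<in>set es. closed_segment a b)"
  shows "real (card U) * \<epsilon> \<le> (\<Sum>(a, b)\<leftarrow>es. dist a b)"
proof -
  have "ennreal (real (card U) * \<epsilon>) \<le> hausdorff_measure1 (\<Union>u\<in>U. closed_segment x (x + \<epsilon> *\<^sub>R u))"
    using assms(3-5) by (rule hausdorff_measure1_spokes_ge)
  also have "\<dots> \<le> hausdorff_measure1 C" using assms(2) by (rule hausdorff_measure1_mono)
  also have "\<dots> \<le> hausdorff_measure1 (\<Union>(a, b)\<in>set es. closed_segment a b)"
    using assms(1,6,7) unfolding steiner_tree_def by blast
  also have "\<dots> \<le> ennreal (\<Sum>(a, b)\<leftarrow>es. dist a b)" by (rule hausdorff_measure1_segments_le)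
  finally have "ennreal (real (card U) * \<epsilon>) \<le> ennreal (\<Sum>(a, b)\<leftarrow>es. dist a b)" .
  moreover have "0 \<le> (\<Sum>(a, b)\<leftarrow>es. dist a b)" by (rule sum_list_nonneg) auto
  ultimately show ?thesis by (simp add: ennreal_le_iff)
qed

lemma connected_segments_from_point: "connected (\<Union>c\<in>A. closed_segment x c)"
  for x :: "'a::euclidean_space"
proof (cases "A = {}")
  case False
  then have "x \<in> \<Inter> (closed_segment x ` A)" by auto
  then show ?thesis by (intro connected_Union) auto
qed simp

text \<open>Two spokes at an angle below 120 degrees can be merged into a common stem along their bisector.
  A stem of length \<open>\<delta> * norm (u + v)\<close> shortens the two legs together by \<open>\<delta> * (norm (u + v))\<^sup>2\<close>, to
  first order, and the angle condition says precisely that \<open>norm (u + v) > 1\<close>.\<close>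
lemma spokes_shortcut:
  fixes u v :: "'a::real_inner"
  assumes "norm u = 1" "norm v = 1" "- 1 / 2 < u \<bullet> v" "0 < \<epsilon>"
  shows "\<exists>\<delta>. norm (\<delta> *\<^sub>R (u + v)) + norm (\<epsilon> *\<^sub>R u - \<delta> *\<^sub>R (u + v)) + norm (\<epsilon> *\<^sub>R v - \<delta> *\<^sub>R (u + v)) < 2 * \<epsilon>"
proof -
  define s where "s = norm (u + v)"
  \<comment> \<open>small enough for the quadratic error term, which requires \<open>3/4 * \<delta> * s < \<epsilon> * (s - 1)\<close>\<close>
  define \<delta> where "\<delta> = \<epsilon> * (s - 1) / s"
  have uv: "u \<bullet> u = 1" "v \<bullet> v = 1" using assms(1,2) by (simp_all add: dot_square_norm)
  have s2: "s\<^sup>2 = 2 + 2 * (u \<bullet> v)"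
    unfolding s_def power2_norm_eq_inner by (simp add: inner_simps inner_commute uv)
  have s: "1 < s" "s \<le> 2"
    using power2_less_imp_less[of 1 s] s2 assms(3) norm_triangle_ineq[of u v] assms(1,2) by (auto simp: s_def)
  have \<delta>s: "\<delta> * s = \<epsilon> * (s - 1)" using s by (simp add: \<delta>_def)
  have \<delta>: "0 < \<delta>" using s assms(4) by (simp add: \<delta>_def)
  have leg: "norm (\<epsilon> *\<^sub>R w - \<delta> *\<^sub>R (u + v)) < \<epsilon> - \<delta> * s / 2" if w: "w \<in> {u, v}" for w
  proof (rule power2_less_imp_less)
    have ww: "w \<bullet> w = 1" "w \<bullet> (u + v) = s\<^sup>2 / 2"
      using w uv s2 by (auto simp: inner_simps inner_commute)
    have "(norm (\<epsilon> *\<^sub>R w - \<delta> *\<^sub>R (u + v)))\<^sup>2 = \<epsilon>\<^sup>2 * (w \<bullet> w) - 2 * \<epsilon> * \<delta> * (w \<bullet> (u + v)) + \<delta>\<^sup>2 * ((u + v) \<bullet> (u + v))"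
      unfolding power2_norm_eq_inner
      by (simp only: inner_diff_left inner_diff_right inner_scaleR_left inner_scaleR_right inner_commute[of "u + v" w])
        (simp add: power2_eq_square algebra_simps)
    also have "\<dots> = \<epsilon>\<^sup>2 - \<epsilon> * (\<delta> * s) * s + (\<delta> * s)\<^sup>2"
      unfolding ww by (simp add: s_def power2_norm_eq_inner power_mult_distrib power2_eq_square flip: power2_norm_eq_inner)
    also have "\<dots> < (\<epsilon> - \<delta> * s / 2)\<^sup>2"
    proof -
      have "(\<epsilon> - \<delta> * s / 2)\<^sup>2 - (\<epsilon>\<^sup>2 - \<epsilon> * (\<delta> * s) * s + (\<delta> * s)\<^sup>2) = (\<delta> * s) * (\<epsilon> * (s - 1) - 3 / 4 * (\<delta> * s))"
        by (simp add: power2_eq_square field_simps)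
      also have "\<dots> = (\<epsilon> * (s - 1))\<^sup>2 / 4" unfolding \<delta>s by (simp add: power2_eq_square)
      also have "0 < \<dots>" using s assms(4) by simp
      finally show ?thesis by simp
    qed
    finally show "(norm (\<epsilon> *\<^sub>R w - \<delta> *\<^sub>R (u + v)))\<^sup>2 < (\<epsilon> - \<delta> * s / 2)\<^sup>2" .
    have "\<epsilon> * (s - 1) \<le> \<epsilon> * 1" using s assms(4) by (intro mult_left_mono) auto
    then show "0 \<le> \<epsilon> - \<delta> * s / 2" using assms(4) unfolding \<delta>s by simp
  qed
  have "norm (\<delta> *\<^sub>R (u + v)) = \<delta> * s" using \<delta> by (simp add: s_def)
  then show ?thesis using leg[of u] leg[of v] by (intro exI[of _ \<delta>]) auto
qed

text \<open>The squared norm of a sum of unit vectors is nonnegative, whereas inner products of at most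
  \<open>-1/2\<close> make it at most 0 for three vectors and negative for four.\<close>
lemma wide_directions_few:
  fixes U :: "'a::real_inner set"
  assumes unit: "\<And>u. u \<in> U \<Longrightarrow> norm u = 1"
    and wide: "\<And>u v. u \<in> U \<Longrightarrow> v \<in> U \<Longrightarrow> u \<noteq> v \<Longrightarrow> u \<bullet> v \<le> - 1 / 2"
  shows "card U \<le> 3" "card U = 3 \<Longrightarrow> \<exists>u v w. U = {u, v, w} \<and> u + v + w = 0"
proof -
  have sq: "u \<bullet> u = 1" if "u \<in> U" for u using unit[OF that] by (simp add: dot_square_norm)
  show "card U \<le> 3"
  proof (rule ccontr)
    assume "\<not> card U \<le> 3"
    then obtain T where T: "T \<subseteq> U" "card T = 4"
      using obtain_subset_with_card_n[of 4 U] by auto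
    then obtain a b c d where abcd: "T = {a, b, c, d}" "distinct [a, b, c, d]"
      by (auto simp: numeral_eq_Suc card_Suc_eq)
    let ?z = "a + b + c + d"
    have "?z \<bullet> ?z = a \<bullet> a + b \<bullet> b + c \<bullet> c + d \<bullet> d
        + 2 * (a \<bullet> b + a \<bullet> c + a \<bullet> d + b \<bullet> c + b \<bullet> d + c \<bullet> d)"
      by (simp add: inner_simps inner_commute algebra_simps)
    also have "\<dots> < 0"
      using sq[of a] sq[of b] sq[of c] sq[of d] wide[of a b] wide[of a c] wide[of a d] wide[of b c] wide[of b d]
        wide[of c d] abcd T(1) by auto
    finally show False using inner_ge_zero[of ?z] by simp
  qed
  assume "card U = 3"
  then obtain a b c where abc: "U = {a, b, c}" "distinct [a, b, c]"
    by (auto simp: numeral_eq_Suc card_Suc_eq)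
  let ?z = "a + b + c"
  have "?z \<bullet> ?z = a \<bullet> a + b \<bullet> b + c \<bullet> c + 2 * (a \<bullet> b + a \<bullet> c + b \<bullet> c)"
    by (simp add: inner_simps inner_commute algebra_simps)
  also have "\<dots> \<le> 0"
    using sq[of a] sq[of b] sq[of c] wide[of a b] wide[of a c] wide[of b c] abc by auto
  finally have "?z = 0" using inner_ge_zero[of ?z] by (metis antisym inner_eq_zero_iff)
  then show "\<exists>u v w. U = {u, v, w} \<and> u + v + w = 0" using abc(1) by blast
qed

definition balanced_directions :: "(real^2) set \<Rightarrow> bool" where
  "balanced_directions U \<longleftrightarrow> U = {} \<or> (\<exists>u. U = {u, - u}) \<or> (\<exists>u v w. U = {u, v, w} \<and> u + v + w = 0)"

text \<open>Competitors rule out the remaining configurations: a single spoke loses to a point, a narrow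
  pair to a pair with a stem, and a bent pair to its chord.\<close>
lemma locally_minimal_tree_balanced:
  assumes lmt: "locally_minimal_tree P S" and "x \<notin> P"
  shows "balanced_directions (directions S x)"
proof (cases "x \<in> S")
  case False
  then show ?thesis by (simp add: directions_outside balanced_directions_def)
next
  case True
  define U where "U = directions S x"
  have unit: "norm u = 1" if "u \<in> U" for u using that by (simp add: U_def directions_def)
  have segs: "finite_union_of_segments S" using lmt by (simp add: locally_minimal_tree_def)
  have fin: "finite U" unfolding U_def by (rule star_radius_exists[OF segs])
  obtain r where r: "star_radius S x r" using star_radius_exists[OF segs] by blast
  then have "0 < r" by (simp add: star_radius_def)
  have "\<forall>\<^sub>F \<epsilon> in at_right 0. steiner_tree (({x} \<inter> P) \<union> (S \<inter> sphere x \<epsilon>)) (closure (S \<inter> ball x \<epsilon>))"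
    using lmt True by (simp add: locally_minimal_tree_def)
  moreover have "\<forall>\<^sub>F \<epsilon> in at_right 0. \<epsilon> < r"
    using \<open>0 < r\<close> by (auto simp: eventually_at_right_field)
  moreover have "\<forall>\<^sub>F \<epsilon> in at_right (0::real). 0 < \<epsilon>" by (rule eventually_at_right_less)
  ultimately have "\<forall>\<^sub>F \<epsilon> in at_right 0. 0 < \<epsilon> \<and> \<epsilon> < r \<and>
      steiner_tree (({x} \<inter> P) \<union> (S \<inter> sphere x \<epsilon>)) (closure (S \<inter> ball x \<epsilon>))"
    by eventually_elim auto
  then obtain \<epsilon> where \<epsilon>: "0 < \<epsilon>" "\<epsilon> < r"
      "steiner_tree (({x} \<inter> P) \<union> (S \<inter> sphere x \<epsilon>)) (closure (S \<inter> ball x \<epsilon>))"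
    using eventually_happens'[of "at_right (0::real)"] by (auto simp: trivial_limit_at_right_real)
  have sphere: "S \<inter> sphere x \<epsilon> = (\<lambda>u. x + \<epsilon> *\<^sub>R u) ` U"
  proof
    show "S \<inter> sphere x \<epsilon> \<subseteq> (\<lambda>u. x + \<epsilon> *\<^sub>R u) ` U"
    proof
      fix y assume y: "y \<in> S \<inter> sphere x \<epsilon>"
      then have "y \<noteq> x" "dist x y < r" "norm (y - x) = \<epsilon>" using \<epsilon> by (auto simp: dist_norm norm_minus_commute)
      then have "sgn (y - x) \<in> U" "y = x + \<epsilon> *\<^sub>R sgn (y - x)"
        using y r by (auto simp: U_def star_radius_def sgn_div_norm)
      then show "y \<in> (\<lambda>u. x + \<epsilon> *\<^sub>R u) ` U" by blast
    qed
    show "(\<lambda>u. x + \<epsilon> *\<^sub>R u) ` U \<subseteq> S \<inter> sphere x \<epsilon>"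
    proof clarify
      fix u assume u: "u \<in> U"
      then show "x + \<epsilon> *\<^sub>R u \<in> S \<inter> sphere x \<epsilon>"
        using star_radius_ray[OF r unit[OF u] \<epsilon>(1,2)] unit[OF u] \<epsilon>(1) by (auto simp: U_def dist_norm)
    qed
  qed
  have spokes: "closed_segment x (x + \<epsilon> *\<^sub>R u) \<subseteq> closure (S \<inter> ball x \<epsilon>)" if u: "u \<in> U" for u
  proof -
    have "open_segment x (x + \<epsilon> *\<^sub>R u) \<subseteq> S \<inter> ball x \<epsilon>"
    proof
      fix y assume "y \<in> open_segment x (x + \<epsilon> *\<^sub>R u)"
      then obtain s where s: "0 < s" "s < 1" "y = x + (s * \<epsilon>) *\<^sub>R u"
        by (auto simp: in_segment algebra_simps)
      moreover have "0 < s * \<epsilon>" "s * \<epsilon> < \<epsilon>" using s \<epsilon>(1) by auto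
      ultimately show "y \<in> S \<inter> ball x \<epsilon>"
        using star_radius_ray[OF r unit[OF u], of "s * \<epsilon>"] unit[OF u] u \<epsilon>(2) by (auto simp: U_def dist_norm)
    qed
    then have "closure (open_segment x (x + \<epsilon> *\<^sub>R u)) \<subseteq> closure (S \<inter> ball x \<epsilon>)" by (rule closure_mono)
    then show ?thesis using unit[OF u] \<epsilon>(1) by (auto split: if_splits)
  qed
  have st: "steiner_tree ((\<lambda>u. x + \<epsilon> *\<^sub>R u) ` U) (closure (S \<inter> ball x \<epsilon>))"
    using \<epsilon>(3) assms(2) sphere by simp
  have optimal: "real (card U) * \<epsilon> \<le> (\<Sum>(a, b)\<leftarrow>es. dist a b)"
    if "connected (\<Union>(a, b)\<in>set es. closed_segment a b)"
      "\<And>u. u \<in> U \<Longrightarrow> \<exists>(a, b)\<in>set es. x + \<epsilon> *\<^sub>R u \<in> closed_segment a b" for es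
    by (rule steiner_tree_spokes_le[OF st _ fin unit \<epsilon>(1) that(1)]) (use spokes that(2) in \<open>auto, blast\<close>)
  have wide: "u \<bullet> v \<le> - 1 / 2" if uv: "u \<in> U" "v \<in> U" "u \<noteq> v" for u v
  proof (rule ccontr)
    assume "\<not> u \<bullet> v \<le> - 1 / 2"
    then obtain \<delta> where \<delta>: "norm (\<delta> *\<^sub>R (u + v)) + norm (\<epsilon> *\<^sub>R u - \<delta> *\<^sub>R (u + v)) + norm (\<epsilon> *\<^sub>R v - \<delta> *\<^sub>R (u + v)) < 2 * \<epsilon>"
      using spokes_shortcut[OF unit[OF uv(1)] unit[OF uv(2)] _ \<epsilon>(1)] by auto
    have two: "2 \<le> card U" using card_mono[OF fin, of "{u, v}"] uv by simp
    define q where "q = x + \<delta> *\<^sub>R (u + v)"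
    obtain ws where ws: "set ws = U - {u, v}" "distinct ws" using finite_distinct_list[of "U - {u, v}"] fin by auto
    \<comment> \<open>the spokes along \<open>u\<close> and \<open>v\<close> are replaced by a stem with two legs, the others are kept\<close>
    define es where "es = (x, q) # (q, x + \<epsilon> *\<^sub>R u) # (q, x + \<epsilon> *\<^sub>R v) # map (\<lambda>w. (x, x + \<epsilon> *\<^sub>R w)) ws"
    let ?A = "\<Union>c\<in>insert q ((\<lambda>w. x + \<epsilon> *\<^sub>R w) ` set ws). closed_segment x c"
    let ?B = "\<Union>c\<in>{x + \<epsilon> *\<^sub>R u, x + \<epsilon> *\<^sub>R v}. closed_segment q c"
    have "q \<in> ?A \<inter> ?B" by auto
    then have "connected (?A \<union> ?B)"
      by (intro connected_Un connected_segments_from_point) auto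
    also have "?A \<union> ?B = (\<Union>(a, b)\<in>set es. closed_segment a b)"
      by (auto simp: es_def)
    finally have "real (card U) * \<epsilon> \<le> (\<Sum>(a, b)\<leftarrow>es. dist a b)"
      by (rule optimal) (auto simp: es_def ws)
    also have "\<dots> = dist x q + dist q (x + \<epsilon> *\<^sub>R u) + dist q (x + \<epsilon> *\<^sub>R v) + (\<Sum>w\<leftarrow>ws. dist x (x + \<epsilon> *\<^sub>R w))"
      by (simp add: es_def comp_def)
    also have "(\<Sum>w\<leftarrow>ws. dist x (x + \<epsilon> *\<^sub>R w)) = (\<Sum>w\<in>U - {u, v}. \<epsilon>)"
      using ws unit \<epsilon>(1) by (simp add: sum_list_distinct_conv_sum_set dist_norm)
    also have "\<dots> = (real (card U) - 2) * \<epsilon>"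
      using uv fin two by (simp add: card_Diff_subset of_nat_diff)
    also have "dist x q + dist q (x + \<epsilon> *\<^sub>R u) + dist q (x + \<epsilon> *\<^sub>R v) =
        norm (\<delta> *\<^sub>R (u + v)) + norm (\<epsilon> *\<^sub>R u - \<delta> *\<^sub>R (u + v)) + norm (\<epsilon> *\<^sub>R v - \<delta> *\<^sub>R (u + v))"
      by (simp add: q_def dist_norm norm_minus_commute algebra_simps)
    finally have "real (card U) * \<epsilon> < 2 * \<epsilon> + (real (card U) - 2) * \<epsilon>" using \<delta> by simp
    then show False by (simp add: algebra_simps)
  qed
  note few = wide_directions_few[of U, OF unit wide]
  have "card U \<noteq> 1"
  proof
    assume "card U = 1"
    then obtain u where "U = {u}" by (auto simp: card_1_singleton_iff)
    then have "real (card U) * \<epsilon> \<le> 0"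
      using optimal[of "[(x + \<epsilon> *\<^sub>R u, x + \<epsilon> *\<^sub>R u)]"] by simp
    then show False using \<open>card U = 1\<close> \<epsilon>(1) by simp
  qed
  moreover have "\<exists>u. U = {u, - u}" if "card U = 2"
  proof -
    obtain u v where uv: "U = {u, v}" "u \<noteq> v" using \<open>card U = 2\<close> by (auto simp: card_2_iff)
    have "real (card U) * \<epsilon> \<le> dist (x + \<epsilon> *\<^sub>R u) (x + \<epsilon> *\<^sub>R v)"
      using optimal[of "[(x + \<epsilon> *\<^sub>R u, x + \<epsilon> *\<^sub>R v)]"] by (auto simp: uv)
    also have "\<dots> = \<epsilon> * norm (u - v)"
      using \<epsilon>(1) by (simp add: dist_norm flip: scaleR_diff_right)
    finally have "2 \<le> norm (u - v)" using \<epsilon>(1) that by simp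
    then have "4 \<le> (norm (u - v))\<^sup>2" using power_mono[of 2 "norm (u - v)" 2] by simp
    moreover have "(norm (u - v))\<^sup>2 + (norm (u + v))\<^sup>2 = 2 * (norm u)\<^sup>2 + 2 * (norm v)\<^sup>2"
      by (simp add: power2_norm_eq_inner inner_simps inner_commute)
    moreover have "norm u = 1" "norm v = 1" using unit uv by auto
    ultimately have "(norm (u + v))\<^sup>2 \<le> 0" by (simp only: power_one)
    then have "v = - u" by (simp add: add_eq_0_iff)
    then show ?thesis using uv by blast
  qed
  moreover have "card U = 0 \<or> card U = 1 \<or> card U = 2 \<or> card U = 3" using few(1) by linarith
  ultimately show ?thesis
    using few(2) fin unfolding balanced_directions_def U_def[symmetric] by auto
qed

section \<open>Acyclic unions of segments do not separate the plane\<close>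

text \<open>The points of \<open>C\<close> nearest to \<open>z\<close> on the two sides of \<open>z\<close> bound the gap around \<open>z\<close>.\<close>
lemma gap_endpoints:
  fixes C :: "'a::euclidean_space set"
  assumes "closed C" "p \<in> C" "q \<in> C" "z \<in> closed_segment p q" "z \<notin> C"
  obtains p' q' where "p' \<in> C" "q' \<in> C" "p' \<noteq> q'" "closed_segment p' q' \<subseteq> closed_segment p q"
    "closed_segment p' q' \<inter> C = {p', q'}"
proof -
  have near: "\<exists>x'\<in>C. x' \<in> closed_segment x z \<and> closed_segment x' z \<inter> C = {x'}" if "x \<in> C" for x
  proof -
    let ?K = "closed_segment x z \<inter> C"
    have "compact ?K" "?K \<noteq> {}" using assms(1) that by auto
    then obtain x' where x': "x' \<in> ?K" "\<And>y. y \<in> ?K \<Longrightarrow> dist z x' \<le> dist z y"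
      using distance_attains_inf[of ?K z] compact_imp_closed by blast
    have "y = x'" if y: "y \<in> closed_segment x' z" "y \<in> C" for y
    proof -
      have "y \<in> ?K" using y x'(1) closed_segment_subset[of x' "closed_segment x z" z] by auto
      then have "dist z x' \<le> dist z y" by (rule x'(2))
      moreover have "dist x' z = dist x' y + dist y z" using y(1) between_mem_segment between by metis
      ultimately show ?thesis by (simp add: dist_commute)
    qed
    then show ?thesis using x'(1) by auto
  qed
  obtain p' where p': "p' \<in> C" "p' \<in> closed_segment p z" "closed_segment p' z \<inter> C = {p'}"
    using near[OF assms(2)] by blast
  obtain q' where q': "q' \<in> C" "q' \<in> closed_segment q z" "closed_segment q' z \<inter> C = {q'}"
    using near[OF assms(3)] by blast
  have sub: "closed_segment p z \<union> closed_segment z q = closed_segment p q"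
    by (rule Un_closed_segment[OF assms(4)])
  have zin: "z \<in> closed_segment p' q'"
  proof -
    have "between (p, q) z" "between (p, z) p'" "between (q, z) q'"
      using assms(4) p'(2) q'(2) by (auto simp: between_mem_segment)
    then have "between (q, p') z" "between (z, q) q'"
      using between_trans_2[of p q z p'] by (simp_all add: between_commute)
    then have "between (p', q') z" by (rule between_trans_2)
    then show ?thesis by (simp add: between_mem_segment)
  qed
  have un: "closed_segment p' z \<union> closed_segment z q' = closed_segment p' q'"
    by (rule Un_closed_segment[OF zin])
  show ?thesis
  proof (rule that)
    show "closed_segment p' q' \<inter> C = {p', q'}"
      using un p'(3) q'(3) by (auto simp: closed_segment_commute)
    show "closed_segment p' q' \<subseteq> closed_segment p q"
      using p'(2) q'(2) sub by (intro closed_segment_subset) (auto simp: closed_segment_commute)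
    show "p' \<noteq> q'" using zin p'(1) assms(5) by auto
  qed (use p' q' in auto)
qed

text \<open>A gap of \<open>C\<close> on the segment, closed up by an arc within \<open>C\<close> between its two ends.\<close>
lemma loop_from_arc_and_gap:
  fixes C :: "'a::euclidean_space set"
  assumes "path_connected C" "closed C" "\<not> connected (closed_segment c d \<inter> C)"
  shows "\<exists>g. simple_path g \<and> pathfinish g = pathstart g \<and> path_image g \<subseteq> closed_segment c d \<union> C"
proof -
  have "\<not> convex (closed_segment c d \<inter> C)" using assms(3) convex_connected by blast
  then obtain p q z where pq: "p \<in> closed_segment c d" "p \<in> C" "q \<in> closed_segment c d" "q \<in> C"
    "z \<in> closed_segment p q" "z \<notin> closed_segment c d \<inter> C"
    by (auto simp: convex_contains_segment)
  have sub: "closed_segment p q \<subseteq> closed_segment c d" using pq by (simp add: closed_segment_subset)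
  then have "z \<notin> C" using pq by auto
  obtain p' q' where *: "p' \<in> C" "q' \<in> C" "p' \<noteq> q'" "closed_segment p' q' \<subseteq> closed_segment p q"
    "closed_segment p' q' \<inter> C = {p', q'}"
    by (rule gap_endpoints[OF assms(2) pq(2,4,5) \<open>z \<notin> C\<close>])
  obtain g where g: "arc g" "path_image g \<subseteq> C" "pathstart g = p'" "pathfinish g = q'"
    using assms(1) *(1-3) unfolding path_connected_arcwise by metis
  have "simple_path (g +++ linepath q' p')"
    using g *(3,5) by (intro simple_path_join_loop) (auto simp: closed_segment_commute)
  then show ?thesis
    using g *(4) sub by (intro exI[of _ "g +++ linepath q' p'"])
      (auto simp: path_image_join closed_segment_commute)
qed

text \<open>Induction on the number of segments. One segment is taken away and the path components of the
  rest, which are unions of fewer segments, are added back to it one at a time. Acyclicity makes the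
  intersection of each component with the segment connected, which is what Janiszewski's theorem asks
  for. Path components are used because an arc within the component is needed to close up a loop.\<close>
lemma acyclic_segments_nonseparating:
  fixes F :: "(complex \<times> complex) set"
  assumes "finite F"
    and "\<nexists>g. simple_path g \<and> pathfinish g = pathstart g \<and> path_image g \<subseteq> (\<Union>(a, b)\<in>F. closed_segment a b)"
  shows "connected (- (\<Union>(a, b)\<in>F. closed_segment a b))"
  using assms
proof (induction F rule: finite_psubset_induct)
  case (psubset F)
  let ?U = "\<lambda>F. \<Union>(a, b)\<in>F. closed_segment a b"
  show ?case
  proof (cases "F = {}")
    case False
    then obtain c d where cd: "(c, d) \<in> F" by auto
    let ?F = "F - {(c, d)}" and ?e = "closed_segment c d"
    define V where "V = ?U ?F"
    have U: "?U F = ?e \<union> V" using cd by (auto simp: V_def)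
    define comps where "comps = path_component_set V ` V"
    define sub where "sub C = {(a, b) \<in> ?F. closed_segment a b \<subseteq> C}" for C
    have comp_of: "path_component_set V y = C" if "C \<in> comps" "y \<in> C" for C y
    proof -
      obtain x where x: "C = path_component_set V x" using \<open>C \<in> comps\<close> by (auto simp: comps_def)
      show ?thesis using path_component_eq[of y V x] that(2) unfolding x by blast
    qed
    have comp_eq: "C = ?U (sub C)" if C: "C \<in> comps" for C
    proof
      show "C \<subseteq> ?U (sub C)"
      proof
        fix y assume y: "y \<in> C"
        have "C \<subseteq> V" using C path_component_subset by (auto simp: comps_def)
        then have "y \<in> V" using y by blast
        then obtain a b where ab: "(a, b) \<in> ?F" "y \<in> closed_segment a b"
          unfolding V_def by blast
        have "closed_segment a b \<subseteq> V" using ab(1) by (auto simp: V_def)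
        then have "closed_segment a b \<subseteq> path_component_set V y"
          using ab by (intro path_component_maximal) auto
        also have "path_component_set V y = C" using y by (rule comp_of[OF C])
        finally show "y \<in> ?U (sub C)" using ab by (auto simp: sub_def)
      qed
    qed (auto simp: sub_def)
    have clo: "closed (?U G)" if "G \<subseteq> F" for G
      using finite_subset[OF that psubset(1)] by (intro closed_UN) auto
    have "finite (Pow F)" using psubset(1) by simp
    moreover have "comps \<subseteq> ?U ` Pow F"
    proof
      fix C assume "C \<in> comps"
      then have "C = ?U (sub C)" by (rule comp_eq)
      moreover have "sub C \<in> Pow F" by (auto simp: sub_def)
      ultimately show "C \<in> ?U ` Pow F" by (rule image_eqI)
    qed
    ultimately have fin: "finite comps" by (meson finite_imageI finite_subset)
    have step: "connected (- (?e \<union> \<Union>D))" if "finite D" "D \<subseteq> comps" for D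
      using that
    proof (induction D rule: finite_induct)
      case empty
      then show ?case by (simp add: connected_complement_bounded_convex bounded_closed_segment)
    next
      case (insert C D)
      have C: "C \<in> comps" using insert by auto
      have subF: "sub C \<subset> F" using cd by (auto simp: sub_def)
      have cl: "closed C" using clo[of "sub C"] comp_eq[OF C] subF by auto
      have comp: "compact (?e \<union> \<Union>D)"
      proof (intro compact_Un compact_Union)
        fix X assume "X \<in> D"
        then have "X = ?U (sub X)" using comp_eq insert.prems by blast
        moreover have "finite (sub X)"
          by (rule finite_subset[OF _ psubset(1)]) (auto simp: sub_def)
        ultimately show "compact X" by (metis (no_types, lifting) compact_UN compact_segment(1) case_prod_beta)
      qed (use insert in auto)
      have "(?e \<union> \<Union>D) \<inter> C = ?e \<inter> C"
      proof -
        have "X \<inter> C = {}" if "X \<in> D" for X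
        proof (rule ccontr)
          assume "X \<inter> C \<noteq> {}"
          then obtain y where "y \<in> X" "y \<in> C" by blast
          then have "X = C" using comp_of[of X y] comp_of[of C y] that C insert.prems by blast
          then show False using that insert.hyps by blast
        qed
        then show ?thesis by auto
      qed
      moreover have "path_connected C" using C by (auto simp: comps_def)
      moreover have "?e \<union> C \<subseteq> ?U F"
        using U C path_component_subset by (auto simp: comps_def)
      ultimately have "connected ((?e \<union> \<Union>D) \<inter> C)"
        using loop_from_arc_and_gap[OF _ cl] psubset.prems by (metis order_trans)
      moreover have "connected (- C)"
        using psubset.IH[OF subF] psubset.prems comp_eq[OF C] subF
        by (metis (no_types, lifting) UN_mono order_trans psubset_imp_subset subset_refl)
      ultimately show ?case
        using Janiszewski_connected[OF comp cl] insert by (simp add: Un_ac)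
    qed
    have "\<Union>comps = V"
      using path_component_subset by (auto simp: comps_def path_component_refl_eq)
    then show ?thesis using step[OF fin] U by simp
  qed (simp add: connected_UNIV)
qed

section \<open>The stress function of a balanced lattice field\<close>

definition weighted_sum :: "(real \<Rightarrow> int) \<Rightarrow> (real \<Rightarrow> real) \<Rightarrow> real" where
  "weighted_sum w f = (\<Sum>y | w y \<noteq> 0. of_int (w y) * f y)"

text \<open>Up to sign the slope at \<open>q\<close> of the sum of the weighted hinges \<open>max 0 (y - q)\<close>.\<close>
definition tail_weight :: "(real \<Rightarrow> int) \<Rightarrow> real \<Rightarrow> int" where
  "tail_weight w q = (\<Sum>y | w y \<noteq> 0 \<and> q < y. w y)"

lemma weighted_sum_shift:
  assumes "\<And>y. w' (y + s) = w y"
  shows "weighted_sum w' f = weighted_sum w (\<lambda>y. f (y + s))"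
  unfolding weighted_sum_def
  by (rule sum.reindex_bij_witness[where i = "\<lambda>y. y + s" and j = "\<lambda>y. y - s"])
    (use assms assms[of "_ - s"] in auto)

lemma tail_weight_shift:
  assumes "\<And>y. w' (y + s) = w y"
  shows "tail_weight w' (q + s) = tail_weight w q"
  unfolding tail_weight_def
  by (rule sum.reindex_bij_witness[where i = "\<lambda>y. y + s" and j = "\<lambda>y. y - s"])
    (use assms assms[of "_ - s"] in auto)

lemma weighted_sum_superset:
  assumes "finite F" "{y. w y \<noteq> 0} \<subseteq> F"
  shows "weighted_sum w f = (\<Sum>y\<in>F. of_int (w y) * f y)"
  unfolding weighted_sum_def by (rule sum.mono_neutral_left) (use assms in auto)

lemma tail_weight_superset:
  assumes "finite F" "{y. w y \<noteq> 0} \<subseteq> F"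
  shows "tail_weight w q = (\<Sum>y\<in>F \<inter> {q<..}. w y)"
  unfolding tail_weight_def by (rule sum.mono_neutral_left) (use assms in auto)

lemma weighted_sum_add:
  assumes "finite {y. w y \<noteq> 0}" "finite {y. w' y \<noteq> 0}"
  shows "weighted_sum (\<lambda>y. w y + w' y) f = weighted_sum w f + weighted_sum w' f"
proof -
  let ?F = "{y. w y \<noteq> 0} \<union> {y. w' y \<noteq> 0}"
  have "weighted_sum v f = (\<Sum>y\<in>?F. of_int (v y) * f y)" if "v \<in> {w, w', \<lambda>y. w y + w' y}" for v
    by (rule weighted_sum_superset) (use that assms in auto)
  then show ?thesis by (simp add: sum.distrib distrib_right)
qed

lemma weighted_sum_uminus: "weighted_sum (\<lambda>y. - w y) f = - weighted_sum w f"
  by (simp add: weighted_sum_def sum_negf)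

lemma tail_weight_add:
  assumes "finite {y. w y \<noteq> 0}" "finite {y. w' y \<noteq> 0}"
  shows "tail_weight (\<lambda>y. w y + w' y) q = tail_weight w q + tail_weight w' q"
proof -
  let ?F = "{y. w y \<noteq> 0} \<union> {y. w' y \<noteq> 0}"
  have "tail_weight v q = (\<Sum>y\<in>?F \<inter> {q<..}. v y)" if "v \<in> {w, w', \<lambda>y. w y + w' y}" for v
    by (rule tail_weight_superset) (use that assms in auto)
  then show ?thesis by (simp add: sum.distrib)
qed

lemma finite_set_gap:
  fixes q :: real
  assumes "finite F"
  shows "\<exists>r>0. \<forall>y\<in>F. y \<noteq> q \<longrightarrow> r \<le> \<bar>y - q\<bar>"
proof -
  have "0 < infdist q (F - {q}) \<or> F - {q} = {}"
    using assms by (metis Diff_iff finite_Diff finite_imp_closed in_closed_iff_infdist_zero infdist_nonneg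
        insertI1 order_le_less)
  then show ?thesis
  proof
    assume "0 < infdist q (F - {q})"
    then show ?thesis
      by (intro exI[of _ "infdist q (F - {q})"])
        (auto simp: dist_real_def abs_minus_commute intro!: infdist_le[THEN order_trans])
  next
    assume "F - {q} = {}"
    then show ?thesis by (intro exI[of _ 1]) auto
  qed
qed

text \<open>Every hinge is linear near \<open>q\<close> except the one at \<open>q\<close> itself, which contributes the kink.\<close>
lemma weighted_sum_hinge_local:
  assumes fin: "finite {y. w y \<noteq> 0}"
  shows "\<exists>r>0. \<forall>t. \<bar>t\<bar> < r \<longrightarrow>
    weighted_sum w (\<lambda>y. max 0 (y - (q + t))) =
    weighted_sum w (\<lambda>y. max 0 (y - q)) - t * of_int (tail_weight w q) + of_int (w q) * max 0 (- t)"
proof -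
  let ?F = "{y. w y \<noteq> 0}"
  obtain r where r: "r > 0" "\<And>y. y \<in> ?F \<Longrightarrow> y \<noteq> q \<Longrightarrow> r \<le> \<bar>y - q\<bar>"
    using finite_set_gap[OF fin, of q] by auto
  have "weighted_sum w (\<lambda>y. max 0 (y - (q + t))) =
    weighted_sum w (\<lambda>y. max 0 (y - q)) - t * of_int (tail_weight w q) + of_int (w q) * max 0 (- t)"
    if t: "\<bar>t\<bar> < r" for t
  proof -
    have "weighted_sum w (\<lambda>y. max 0 (y - (q + t))) =
      (\<Sum>y\<in>?F. of_int (w y) * max 0 (y - q) - t * (if q < y then of_int (w y) else 0)
                + (if y = q then of_int (w q) * max 0 (- t) else 0))"
      unfolding weighted_sum_def
    proof (rule sum.cong[OF refl])
      fix y assume "y \<in> ?F"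
      then have "y = q \<or> y \<ge> q + r \<or> y \<le> q - r" using r(2)[of y] by (auto simp: abs_if split: if_splits)
      then show "of_int (w y) * max 0 (y - (q + t)) = of_int (w y) * max 0 (y - q)
          - t * (if q < y then of_int (w y) else 0) + (if y = q then of_int (w q) * max 0 (- t) else 0)"
        using t r(1) by (auto simp: max_def abs_if algebra_simps split: if_splits)
    qed
    also have "\<dots> = weighted_sum w (\<lambda>y. max 0 (y - q))
        - t * (\<Sum>y\<in>?F. if q < y then of_int (w y) else 0) + of_int (w q) * max 0 (- t)"
      using fin by (simp add: sum.distrib sum_subtractf sum_distrib_left weighted_sum_def sum.delta)
    also have "(\<Sum>y\<in>?F. if q < y then real_of_int (w y) else 0) = of_int (tail_weight w q)"
      unfolding tail_weight_def by (subst sum.inter_filter[symmetric]) (use fin in \<open>auto intro!: sum.cong\<close>)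
    finally show ?thesis .
  qed
  then show ?thesis using r(1) by blast
qed

lemma tail_weight_unchanged_above:
  assumes "\<And>y. w y \<noteq> 0 \<Longrightarrow> \<not> (q < y \<and> y \<le> q') \<and> \<not> (q' < y \<and> y \<le> q)"
  shows "tail_weight w q' = tail_weight w q"
  unfolding tail_weight_def by (rule sum.cong) (use assms in force)+

text \<open>The balanced sets of directions within the lattice, as indicators of the directions east,
  north-east, north, west, south-west and south. The coordinates are affine: north-east is east plus
  north, and consecutive directions in this list are 60 degrees apart in the actual plane. The stars
  are the empty one, the three lines and the two tripods.\<close>
definition balanced_stars :: "(int \<times> int \<times> int \<times> int \<times> int \<times> int) set" where
  "balanced_stars =
     {(0, 0, 0, 0, 0, 0),
      (1, 0, 0, 1, 0, 0), (0, 1, 0, 0, 1, 0), (0, 0, 1, 0, 0, 1),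
      (1, 0, 1, 0, 1, 0), (0, 1, 0, 1, 0, 1)}"

text \<open>With \<open>a\<close> and \<open>b\<close> the tails at a peak, the six quantities required to vanish are, up to sign, the slopes
  of the stress function there in the six lattice directions, in cyclic order. In a real-valued setting the peak could be a point or a
  ridge, where three or two faces meet; the corresponding gradients would have to surround 0
  in a lattice triangle or lattice edge without further lattice points, which integrality excludes.
  The inequalities leave three values each for \<open>a\<close> and \<open>b\<close>, so that there are finitely many cases.\<close>
lemma adjacent_flat_slopes:
  fixes a b e ne n w sw s :: int
  assumes star: "\<exists>x\<in>balanced_stars. \<exists>y\<in>balanced_stars. (e, ne, n, w, sw, s) = x - y"
    and slopes: "b + ne \<le> 0" "0 \<le> a" "0 \<le> a + b" "n \<le> b" "a + n + w \<le> 0" "e + ne + a + b \<le> 0"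
  shows "b + ne = 0 \<and> a = 0 \<or> a = 0 \<and> b = 0 \<or> a + b = 0 \<and> b = n
      \<or> b = n \<and> a + n + w = 0 \<or> a + n + w = 0 \<and> e + ne + a + b = 0 \<or> e + ne + a + b = 0 \<and> b + ne = 0"
proof -
  have small: "\<bar>ne\<bar> \<le> 1" "\<bar>n\<bar> \<le> 1" "\<bar>w\<bar> \<le> 1"
    using star unfolding balanced_stars_def by (auto simp: zero_prod_def)
  have "a = 0 \<or> a = 1 \<or> a = 2" "b = -1 \<or> b = 0 \<or> b = 1"
    using small slopes by linarith+
  moreover obtain x y where "x \<in> balanced_stars" "y \<in> balanced_stars" "(e, ne, n, w, sw, s) = x - y"
    using star by blast
  ultimately show ?thesis
    using slopes unfolding balanced_stars_def insert_iff empty_iff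
    by (elim disjE FalseE) (simp_all add: zero_prod_def)
qed

text \<open>The field records, for each point and each of the six directions, the signed number of edges that
  leave the point in that direction. The second assumption says that the field consists of straight
  edges: near a point it is nonzero only on the six rays from it, where just the two directions along
  the ray occur.\<close>
locale balanced_lattice_field =
  fixes E NE N W SW S :: "real \<Rightarrow> real \<Rightarrow> int" and K :: real
  assumes shape: "\<exists>x\<in>balanced_stars. \<exists>y\<in>balanced_stars.
        (E p q, NE p q, N p q, W p q, SW p q, S p q) = x - y"
    and star: "\<exists>r>0. \<forall>s t. \<bar>s\<bar> < r \<longrightarrow> \<bar>t\<bar> < r \<longrightarrow> (s, t) \<noteq> (0, 0) \<longrightarrow>
        (let e = (if t = 0 then if 0 < s then E p q else W p q else 0);
             ne = (if s = t then if 0 < s then NE p q else SW p q else 0);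
             n = (if s = 0 then if 0 < t then N p q else S p q else 0)
         in E (p + s) (q + t) = e \<and> W (p + s) (q + t) = e \<and>
            NE (p + s) (q + t) = ne \<and> SW (p + s) (q + t) = ne \<and>
            N (p + s) (q + t) = n \<and> S (p + s) (q + t) = n)"
    and bounded: "K \<le> \<bar>p\<bar> \<or> K \<le> \<bar>q\<bar> \<Longrightarrow> E p q = 0 \<and> NE p q = 0 \<and> N p q = 0 \<and>
        W p q = 0 \<and> SW p q = 0 \<and> S p q = 0"
begin

lemma balance: "E p q + NE p q = W p q + SW p q" "NE p q + N p q = SW p q + S p q"
  using shape[of p q] by (auto simp: balanced_stars_def zero_prod_def)

lemma finite_on_vertical:
  shows "finite {y. E p y \<noteq> 0}" "finite {y. NE p y \<noteq> 0}" "finite {y. W p y \<noteq> 0}" "finite {y. SW p y \<noteq> 0}"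
    "finite {y. S p y - N p y \<noteq> 0}"
proof -
  let ?B = "{y. E p y \<noteq> 0 \<or> NE p y \<noteq> 0 \<or> W p y \<noteq> 0 \<or> SW p y \<noteq> 0 \<or> S p y - N p y \<noteq> 0}"
  have "finite ?B"
  proof (rule ccontr)
    assume inf: "infinite ?B"
    have "?B \<subseteq> cball 0 \<bar>K\<bar>"
    proof
      fix y assume "y \<in> ?B"
      then have "\<not> K \<le> \<bar>y\<bar>" using bounded[of p y] by auto
      then show "y \<in> cball 0 \<bar>K\<bar>" by auto
    qed
    then obtain q where q: "q islimpt ?B"
      using inf bounded_infinite_imp_islimpt[of ?B ?B] bounded_subset[OF bounded_cball] by blast
    obtain r where r: "r > 0" "\<And>t. \<bar>t\<bar> < r \<Longrightarrow> t \<noteq> 0 \<Longrightarrow> q + t \<notin> ?B"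
      using star[of p q] by (elim exE conjE) (drule_tac x = 0 in spec, fastforce simp: Let_def)
    obtain y where "y \<in> ?B" "y \<noteq> q" "dist y q < r"
      using q r(1) unfolding islimpt_approachable by blast
    then show False using r(2)[of "y - q"] by (simp add: dist_real_def)
  qed
  then show "finite {y. E p y \<noteq> 0}" "finite {y. NE p y \<noteq> 0}" "finite {y. W p y \<noteq> 0}" "finite {y. SW p y \<noteq> 0}"
     "finite {y. S p y - N p y \<noteq> 0}"
    by (auto elim: rev_finite_subset)
qed

text \<open>Moving a vertical line a little to the east or west moves each of its points along the edges that
  leave it in that sense: on the level for east and west, diagonally for north-east and south-west.
  Since the field is bounded, finitely many of the neighbourhoods from \<open>star\<close> provide a common radius.\<close>
lemma uniform_slice:
  shows "\<exists>r>0. \<forall>s y. 0 < s \<longrightarrow> s < r \<longrightarrow>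
    E (p + s) y = E p y \<and> NE (p + s) (y + s) = NE p y \<and>
    E (p - s) y = W p y \<and> NE (p - s) (y - s) = SW p y"
proof -
  let ?P = "\<lambda>s y. E (p + s) y = E p y \<and> NE (p + s) (y + s) = NE p y \<and>
    E (p - s) y = W p y \<and> NE (p - s) (y - s) = SW p y"
  have "\<exists>r>0. \<forall>s y. 0 < s \<longrightarrow> s < r \<longrightarrow> \<bar>y - q\<bar> < r \<longrightarrow> ?P s y" for q
  proof -
    obtain r where r: "r > 0" "\<And>s t. \<bar>s\<bar> < r \<Longrightarrow> \<bar>t\<bar> < r \<Longrightarrow> (s, t) \<noteq> (0, 0) \<Longrightarrow>
        E (p + s) (q + t) = (if t = 0 then if 0 < s then E p q else W p q else 0) \<and>
        W (p + s) (q + t) = (if t = 0 then if 0 < s then E p q else W p q else 0) \<and>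
        NE (p + s) (q + t) = (if s = t then if 0 < s then NE p q else SW p q else 0) \<and>
        SW (p + s) (q + t) = (if s = t then if 0 < s then NE p q else SW p q else 0)"
      using star[of p q] by (auto simp only: Let_def)
    have "?P s y" if "0 < s" "s < r / 2" "\<bar>y - q\<bar> < r / 2" for s y
    proof -
      have b: "\<bar>s\<bar> < r" "\<bar>- s\<bar> < r" "\<bar>y - q\<bar> < r" "\<bar>y - q + s\<bar> < r" "\<bar>y - q - s\<bar> < r"
        using that by linarith+
      show ?thesis
      proof (cases "y = q")
        case True
        then show ?thesis
          using r(2)[OF b(1), of 0] r(2)[OF b(1), of s] r(2)[OF b(2), of 0] r(2)[OF b(2), of "-s"] that r(1)
          by auto
      next
        case False
        then show ?thesis
          using r(2)[OF b(1,3)] r(2)[OF b(1,4)] r(2)[OF b(2,3)] r(2)[OF b(2,5)] r(2)[OF _ b(3), of 0] that r(1)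
          by (auto simp: algebra_simps)
      qed
    qed
    then show ?thesis using r(1) by (intro exI[of _ "r / 2"]) auto
  qed
  then obtain R where R: "\<And>q. R q > 0" "\<And>q s y. 0 < s \<Longrightarrow> s < R q \<Longrightarrow> \<bar>y - q\<bar> < R q \<Longrightarrow> ?P s y"
    by metis
  let ?C = "{-\<bar>K\<bar> - 1..\<bar>K\<bar> + 1}"
  have "compact ?C" "?C \<subseteq> (\<Union>q\<in>?C. ball q (R q))" using R(1) by auto
  then obtain D where D: "D \<subseteq> ?C" "finite D" "?C \<subseteq> (\<Union>q\<in>D. ball q (R q))"
    using compactE_image[of ?C ?C "\<lambda>q. ball q (R q)"] by (metis open_ball)
  define r where "r = Min (insert 1 (R ` D))"
  have r0: "r > 0" "r \<le> 1" "\<And>q. q \<in> D \<Longrightarrow> r \<le> R q" using D(2) R(1) by (auto simp: r_def)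
  have "?P s y" if s: "0 < s" "s < r" for s y
  proof (cases "y \<in> ?C")
    case True
    then obtain q where "q \<in> D" "\<bar>y - q\<bar> < R q" using D(3) by (auto simp: dist_real_def abs_minus_commute)
    then show ?thesis using R(2)[of s q y] s r0(3)[of q] by auto
  next
    case False
    then have "K \<le> \<bar>y\<bar>" "K \<le> \<bar>y + s\<bar>" "K \<le> \<bar>y - s\<bar>" using s r0(2) by auto
    then show ?thesis using bounded by metis
  qed
  then show ?thesis using r0(1) by blast
qed

text \<open>Going up a vertical line, the signed number of vertical edges at hand drops by \<open>S - N\<close> at each point
  and is 0 in the end. Formally, the difference of the two sides is locally constant in \<open>q\<close>.\<close>
lemma vertical_edge_telescopes: "tail_weight (\<lambda>y. S p y - N p y) q = N p q"
proof -
  let ?w = "\<lambda>y. S p y - N p y"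
  define G where "G q = N p q - tail_weight ?w q" for q
  have fin: "finite {y. ?w y \<noteq> 0}" by (rule finite_on_vertical)
  have loc: "\<exists>r>0. \<forall>q'. \<bar>q' - q\<bar> < r \<longrightarrow> G q' = G q" for q
  proof -
    obtain r1 where r1: "r1 > 0" "\<And>t. \<bar>t\<bar> < r1 \<Longrightarrow> t \<noteq> 0 \<Longrightarrow> N p (q + t) = (if 0 < t then N p q else S p q) \<and> ?w (q + t) = 0"
      using star[of p q] by (elim exE conjE) (drule_tac x = 0 in spec, fastforce simp: Let_def)
    have "G q' = G q" if "\<bar>q' - q\<bar> < r1" for q'
    proof -
      have nz: "?w y = 0" if "y \<noteq> q" "\<bar>y - q\<bar> < r1" for y
        using r1(2)[of "y - q"] that by auto
      consider "q' = q" | "q < q'" | "q' < q" by linarith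
      then show ?thesis
      proof cases
        case 2
        have "tail_weight ?w q' = tail_weight ?w q"
          by (rule tail_weight_unchanged_above) (use nz that 2 in force)
        then show ?thesis using r1(2)[of "q' - q"] 2 that by (simp add: G_def)
      next
        case 3
        have "tail_weight ?w q' = (\<Sum>y\<in>insert q {y. ?w y \<noteq> 0 \<and> q < y}. ?w y)"
          unfolding tail_weight_def
        proof (rule sum.mono_neutral_left)
          show "finite (insert q {y. ?w y \<noteq> 0 \<and> q < y})" using fin by (auto elim: rev_finite_subset)
          show "{y. ?w y \<noteq> 0 \<and> q' < y} \<subseteq> insert q {y. ?w y \<noteq> 0 \<and> q < y}"
            using nz that 3 by force
        qed (use 3 in auto)
        also have "\<dots> = ?w q + tail_weight ?w q"
          unfolding tail_weight_def using fin by (subst sum.insert) (auto elim: rev_finite_subset)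
        finally show ?thesis using r1(2)[of "q' - q"] 3 that by (simp add: G_def)
      qed simp
    qed
    then show ?thesis using r1(1) by blast
  qed
  have const: "G q = G q'" for q q'
  proof (rule connected_local_const[of UNIV q q' G])
    show "\<forall>a\<in>UNIV. \<forall>\<^sub>F b in at a within UNIV. G a = G b"
      using loc unfolding eventually_at dist_real_def by metis
  qed auto
  have "tail_weight ?w \<bar>K\<bar> = 0"
    unfolding tail_weight_def
  proof (rule sum.neutral, rule ballI)
    fix y assume "y \<in> {y. ?w y \<noteq> 0 \<and> \<bar>K\<bar> < y}"
    then have "K \<le> \<bar>y\<bar>" by auto
    then show "?w y = 0" using bounded by simp
  qed
  moreover have "N p \<bar>K\<bar> = 0" using bounded[of p "\<bar>K\<bar>"] abs_ge_self[of K] by simp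
  ultimately have "G \<bar>K\<bar> = 0" by (simp add: G_def)
  then show ?thesis using const[of q "\<bar>K\<bar>"] by (simp add: G_def)
qed

text \<open>The Airy stress function, integrated twice along the upward ray from the point: each edge that
  crosses the ray contributes its weight times the distance to the crossing, measured along the ray. Edges are counted by their eastern
  halves; by balance counting the western halves gives the same (\<open>stress_from_west\<close>).\<close>
definition stress :: "real \<Rightarrow> real \<Rightarrow> real" where
  "stress p q = weighted_sum (E p) (\<lambda>y. max 0 (y - q)) + weighted_sum (NE p) (\<lambda>y. max 0 (y - q))"

lemma tail_west: "tail_weight (W p) q = tail_weight (E p) q + N p q"
  and tail_southwest: "tail_weight (SW p) q = tail_weight (NE p) q - N p q"
proof -
  have "(\<lambda>y. NE p y) = (\<lambda>y. SW p y + (S p y - N p y))"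
    using balance(2)[of p] by (intro ext) (smt (verit))
  then have "tail_weight (NE p) q = tail_weight (SW p) q + tail_weight (\<lambda>y. S p y - N p y) q"
    using tail_weight_add[OF finite_on_vertical(4,5)] by metis
  then show *: "tail_weight (SW p) q = tail_weight (NE p) q - N p q"
    by (simp add: vertical_edge_telescopes)
  have "(\<lambda>y. E p y + NE p y) = (\<lambda>y. W p y + SW p y)"
    by (rule ext) (rule balance(1))
  then have "tail_weight (E p) q + tail_weight (NE p) q = tail_weight (W p) q + tail_weight (SW p) q"
    using tail_weight_add[OF finite_on_vertical(1,2), of p p q] tail_weight_add[OF finite_on_vertical(3,4), of p p q]
    by simp
  then show "tail_weight (W p) q = tail_weight (E p) q + N p q" using * by simp
qed

lemma stress_from_west:
  "stress p q = weighted_sum (W p) (\<lambda>y. max 0 (y - q)) + weighted_sum (SW p) (\<lambda>y. max 0 (y - q))"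
proof -
  have "(\<lambda>y. E p y + NE p y) = (\<lambda>y. W p y + SW p y)"
    by (rule ext) (rule balance(1))
  then show ?thesis
    by (simp add: stress_def flip: weighted_sum_add[OF finite_on_vertical(1,2)]
        weighted_sum_add[OF finite_on_vertical(3,4)])
qed

text \<open>Near each point the stress function is linear on the six sectors between lattice directions. The
  formula for the west is in terms of the tails of \<open>E\<close> and \<open>NE\<close>, too, by \<open>tail_west\<close> and
  \<open>tail_southwest\<close>; so two integers and the star at the point determine all six slopes.\<close>
lemma stress_local:
  "\<exists>r>0. \<forall>s t. \<bar>s\<bar> < r \<longrightarrow> \<bar>t\<bar> < r \<longrightarrow>
     stress (p + s) (q + t) = stress p q
       + (if 0 \<le> s then
            of_int (E p q) * max 0 (- t) + of_int (NE p q) * max 0 (s - t)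
            - t * of_int (tail_weight (E p) q) + (s - t) * of_int (tail_weight (NE p) q)
          else
            of_int (W p q) * max 0 (- t) + of_int (SW p q) * max 0 (s - t)
            - t * of_int (tail_weight (E p) q + N p q) + (s - t) * of_int (tail_weight (NE p) q - N p q))"
proof -
  let ?h = "\<lambda>w t. weighted_sum w (\<lambda>y. max 0 (y - (q + t)))"
  let ?g = "\<lambda>w t. weighted_sum w (\<lambda>y. max 0 (y - q)) - t * of_int (tail_weight w q) + of_int (w q) * max 0 (- t)"
  have "\<exists>r>0. \<forall>t. \<bar>t\<bar> < r \<longrightarrow> ?h w t = ?g w t" if "w \<in> {E p, NE p, W p, SW p}" for w
    by (rule weighted_sum_hinge_local) (use that finite_on_vertical in auto)
  then obtain R where R: "\<And>w t. w \<in> {E p, NE p, W p, SW p} \<Longrightarrow> R w > 0 \<and> (\<bar>t\<bar> < R w \<longrightarrow> ?h w t = ?g w t)"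
    by metis
  obtain r0 where r0: "r0 > 0" "\<And>s y. 0 < s \<Longrightarrow> s < r0 \<Longrightarrow>
    E (p + s) y = E p y \<and> NE (p + s) (y + s) = NE p y \<and>
    E (p - s) y = W p y \<and> NE (p - s) (y - s) = SW p y"
    using uniform_slice[of p] by blast
  define r where "r = Min {r0, R (E p) / 2, R (NE p) / 2, R (W p) / 2, R (SW p) / 2}"
  have r: "r > 0" "r \<le> r0" "\<And>w. w \<in> {E p, NE p, W p, SW p} \<Longrightarrow> r \<le> R w / 2"
    using r0(1) R by (auto simp: r_def)
  have hg: "?h w t = ?g w t" if "w \<in> {E p, NE p, W p, SW p}" "\<bar>t\<bar> < 2 * r" for w t
    using R[OF that(1), of t] r(3)[OF that(1)] that(2) by auto
  have "stress (p + s) (q + t) = stress p q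
       + (of_int (E p q) * max 0 (- t) + of_int (NE p q) * max 0 (s - t)
            - t * of_int (tail_weight (E p) q) + (s - t) * of_int (tail_weight (NE p) q))"
    if "0 \<le> s" "\<bar>s\<bar> < r" "\<bar>t\<bar> < r" for s t
  proof -
    have sl: "E (p + s) y = E p y" "NE (p + s) (y + s) = NE p y" for y
      using r0(2)[of s y] that r(2) by (cases "s = 0"; auto)+
    have "E (p + s) = E p" using sl(1) by (rule ext)
    then have "stress (p + s) (q + t) = ?h (E p) t + ?h (NE p) (t - s)"
      unfolding stress_def weighted_sum_shift[of "NE (p + s)" s "NE p", OF sl(2)]
      by (simp add: algebra_simps)
    also have "\<dots> = ?g (E p) t + ?g (NE p) (t - s)"
      using hg[of "E p" t] hg[of "NE p" "t - s"] that by auto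
    finally show ?thesis unfolding stress_def by (simp add: algebra_simps)
  qed
  moreover have "stress (p + s) (q + t) = stress p q
       + (of_int (W p q) * max 0 (- t) + of_int (SW p q) * max 0 (s - t)
            - t * of_int (tail_weight (E p) q + N p q) + (s - t) * of_int (tail_weight (NE p) q - N p q))"
    if "s < 0" "\<bar>s\<bar> < r" "\<bar>t\<bar> < r" for s t
  proof -
    have sl: "E (p + s) y = W p y" "NE (p + s) (y + s) = SW p y" for y
      using r0(2)[of "- s" y] that r(2) by auto
    have "E (p + s) = W p" using sl(1) by (rule ext)
    then have "stress (p + s) (q + t) = ?h (W p) t + ?h (SW p) (t - s)"
      unfolding stress_def weighted_sum_shift[of "NE (p + s)" s "SW p", OF sl(2)]
      by (simp add: algebra_simps)
    also have "\<dots> = ?g (W p) t + ?g (SW p) (t - s)"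
      using hg[of "W p" t] hg[of "SW p" "t - s"] that by auto
    finally show ?thesis unfolding stress_from_west tail_west[symmetric] tail_southwest[symmetric]
      by (simp add: algebra_simps)
  qed
  ultimately show ?thesis using r(1) by (intro exI[of _ r]) (auto simp: not_le)
qed

lemma stress_near_constant:
  assumes "E p q = 0" "NE p q = 0" "W p q = 0" "SW p q = 0" "N p q = 0"
    "tail_weight (E p) q = 0" "tail_weight (NE p) q = 0"
  shows "\<exists>r>0. \<forall>s t. \<bar>s\<bar> < r \<longrightarrow> \<bar>t\<bar> < r \<longrightarrow> stress (p + s) (q + t) = stress p q"
proof -
  obtain r where "r > 0" and r: "\<And>s t. \<bar>s\<bar> < r \<Longrightarrow> \<bar>t\<bar> < r \<Longrightarrow>
     stress (p + s) (q + t) = stress p q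
       + (if 0 \<le> s then
            of_int (E p q) * max 0 (- t) + of_int (NE p q) * max 0 (s - t)
            - t * of_int (tail_weight (E p) q) + (s - t) * of_int (tail_weight (NE p) q)
          else
            of_int (W p q) * max 0 (- t) + of_int (SW p q) * max 0 (s - t)
            - t * of_int (tail_weight (E p) q + N p q) + (s - t) * of_int (tail_weight (NE p) q - N p q))"
    using stress_local[of p q] by blast
  have "stress (p + s) (q + t) = stress p q" if "\<bar>s\<bar> < r" "\<bar>t\<bar> < r" for s t
    using r[OF that] by (simp add: assms)
  then show ?thesis using \<open>r > 0\<close> by blast
qed

lemma stress_outside_strip:
  assumes "K \<le> \<bar>p\<bar>"
  shows "stress p q = 0"
proof -
  have "E p y = 0" "NE p y = 0" for y using bounded[of p y] assms by simp_all
  then show ?thesis by (simp add: stress_def weighted_sum_def)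
qed

lemma stress_above: "\<bar>K\<bar> \<le> q \<Longrightarrow> stress p q = 0"
proof -
  assume "\<bar>K\<bar> \<le> q"
  then have "K \<le> \<bar>y\<bar>" if "q < y" for y using that by auto
  then have "E p y = 0" "NE p y = 0" if "q < y" for y using bounded[of p y] that by auto
  then have "of_int (E p y) * max 0 (y - q) = 0" "of_int (NE p y) * max 0 (y - q) = 0" for y
    by (cases "q < y"; simp)+
  then show ?thesis unfolding stress_def weighted_sum_def by (simp only: sum.neutral_const add_0)
qed

text \<open>Below the whole field the two tails do not depend on \<open>p\<close>: sliding the vertical line changes
  them only by the vertical edges at height \<open>q\<close>, of which there are none. Hence they have the
  value 0 that they have outside the strip. This expresses the global balance of forces and makes the
  stress function vanish below the field, too.\<close>
lemma tails_below:
  assumes q: "q < - \<bar>K\<bar>"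
  shows "tail_weight (E p) q = 0" "tail_weight (NE p) q = 0"
proof -
  define T where "T p = (tail_weight (E p) q, tail_weight (NE p) q)" for p
  have zero: "K \<le> \<bar>y\<bar>" if "y < - \<bar>K\<bar>" for y using that by auto
  have loc: "\<exists>r>0. \<forall>p'. \<bar>p' - p\<bar> < r \<longrightarrow> T p' = T p" for p
  proof -
    obtain r0 where r0: "r0 > 0" "\<And>s y. 0 < s \<Longrightarrow> s < r0 \<Longrightarrow>
      E (p + s) y = E p y \<and> NE (p + s) (y + s) = NE p y \<and>
      E (p - s) y = W p y \<and> NE (p - s) (y - s) = SW p y"
      using uniform_slice[of p] by blast
    define r where "r = min r0 (- \<bar>K\<bar> - q)"
    have still: "tail_weight w q' = tail_weight w q" if "w \<in> {NE p, SW p}" "\<bar>q' - q\<bar> < r" for w q'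
    proof (rule tail_weight_unchanged_above)
      fix y assume "w y \<noteq> 0"
      then have "\<not> y < - \<bar>K\<bar>" using bounded[of p y] zero[of y] that(1) by auto
      then show "\<not> (q < y \<and> y \<le> q') \<and> \<not> (q' < y \<and> y \<le> q)" using that(2) q by (auto simp: r_def)
    qed
    have "T p' = T p" if "\<bar>p' - p\<bar> < r" for p'
    proof -
      consider "p' = p" | "p < p'" | "p' < p" by linarith
      then show ?thesis
      proof cases
        case 2
        define s where "s = p' - p"
        have s: "0 < s" "s < r0" "p' = p + s" "\<bar>(q - s) - q\<bar> < r" using 2 that by (auto simp: s_def r_def)
        have "E p' = E p" using r0(2)[of s] s by auto
        moreover have "tail_weight (NE p') (q - s + s) = tail_weight (NE p) (q - s)"
          by (rule tail_weight_shift) (use r0(2)[of s] s in auto)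
        ultimately show ?thesis using still[of "NE p" "q - s"] s(4) by (simp add: T_def)
      next
        case 3
        define s where "s = p - p'"
        have s: "0 < s" "s < r0" "p' = p - s" "\<bar>(q + s) - q\<bar> < r" using 3 that by (auto simp: s_def r_def)
        have "E p' = W p" using r0(2)[of s] s by auto
        moreover have "tail_weight (NE p') (q + s + - s) = tail_weight (SW p) (q + s)"
          by (rule tail_weight_shift) (use r0(2)[of s] s in auto)
        moreover have "N p q = 0" using bounded zero q by blast
        ultimately show ?thesis using still[of "SW p" "q + s"] s(4) tail_west[of p q] tail_southwest[of p q]
          by (simp add: T_def)
      qed simp
    qed
    moreover have "0 < r" using r0(1) q by (simp add: r_def)
    ultimately show ?thesis by blast
  qed
  have "T p = T \<bar>K\<bar>"
  proof (rule connected_local_const[of UNIV p "\<bar>K\<bar>" T])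
    show "\<forall>a\<in>UNIV. \<forall>\<^sub>F b in at a within UNIV. T a = T b"
      using loc unfolding eventually_at dist_real_def by (metis (full_types))
  qed auto
  also have "T \<bar>K\<bar> = (0, 0)"
    using bounded[of "\<bar>K\<bar>"] abs_ge_self[of K] by (simp add: T_def tail_weight_def)
  finally show "tail_weight (E p) q = 0" "tail_weight (NE p) q = 0" by (simp_all add: T_def)
qed

lemma stress_below:
  assumes q: "q < - \<bar>K\<bar>"
  shows "stress p q = 0"
proof -
  have K: "K \<le> \<bar>q\<bar>" using q by auto
  have loc: "\<exists>r>0. \<forall>p'. \<bar>p' - p\<bar> < r \<longrightarrow> stress p' q = stress p q" for p
  proof -
    have z: "E p q = 0" "NE p q = 0" "W p q = 0" "SW p q = 0" "N p q = 0"
      using bounded[of p q] K by simp_all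
    obtain r where r: "r > 0" "\<And>s t. \<bar>s\<bar> < r \<Longrightarrow> \<bar>t\<bar> < r \<Longrightarrow> stress (p + s) (q + t) = stress p q"
      using stress_near_constant[OF z tails_below[OF q]] by blast
    have "stress p' q = stress p q" if "\<bar>p' - p\<bar> < r" for p'
      using r(2)[OF that, of 0] r(1) by simp
    then show ?thesis using r(1) by blast
  qed
  have "stress p q = stress \<bar>K\<bar> q"
  proof (rule connected_local_const[of UNIV p "\<bar>K\<bar>" "\<lambda>p. stress p q"])
    show "\<forall>a\<in>UNIV. \<forall>\<^sub>F b in at a within UNIV. stress a q = stress b q"
      using loc unfolding eventually_at dist_real_def by metis
  qed auto
  then show ?thesis using stress_outside_strip[of "\<bar>K\<bar>"] by simp
qed

lemma stress_continuous: "continuous_on UNIV (\<lambda>z. stress (Re z) (Im z))"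
  unfolding continuous_on_eq_continuous_at[OF open_UNIV]
proof
  fix z
  let ?p = "Re z" and ?q = "Im z"
  let ?f = "\<lambda>v. of_int (E ?p ?q) * max 0 (- Im v) + of_int (NE ?p ?q) * max 0 (Re v - Im v)
            - Im v * of_int (tail_weight (E ?p) ?q) + (Re v - Im v) * of_int (tail_weight (NE ?p) ?q)"
  let ?g = "\<lambda>v. of_int (W ?p ?q) * max 0 (- Im v) + of_int (SW ?p ?q) * max 0 (Re v - Im v)
            - Im v * of_int (tail_weight (E ?p) ?q + N ?p ?q)
            + (Re v - Im v) * of_int (tail_weight (NE ?p) ?q - N ?p ?q)"
  obtain r where r: "r > 0" "\<And>s t. \<bar>s\<bar> < r \<Longrightarrow> \<bar>t\<bar> < r \<Longrightarrow>
      stress (?p + s) (?q + t) = stress ?p ?q + (if 0 \<le> s then ?f (Complex s t) else ?g (Complex s t))"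
    using stress_local[of ?p ?q] by auto
  have "((\<lambda>v. \<bar>?f v\<bar> + \<bar>?g v\<bar>) \<longlongrightarrow> \<bar>?f 0\<bar> + \<bar>?g 0\<bar>) (at 0)"
    by (intro tendsto_intros)
  then have lim: "((\<lambda>v. \<bar>?f v\<bar> + \<bar>?g v\<bar>) \<longlongrightarrow> 0) (at 0)" by simp
  have "((\<lambda>v. stress (Re (z + v)) (Im (z + v)) - stress ?p ?q) \<longlongrightarrow> 0) (at 0)"
  proof (rule Lim_null_comparison[OF _ lim])
    have "norm (stress (Re (z + v)) (Im (z + v)) - stress ?p ?q) \<le> \<bar>?f v\<bar> + \<bar>?g v\<bar>" if "dist v 0 < r" for v
    proof -
      have "\<bar>Re v\<bar> < r" "\<bar>Im v\<bar> < r"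
        using that abs_Re_le_cmod[of v] abs_Im_le_cmod[of v] by auto
      from r(2)[OF this] show ?thesis by auto
    qed
    then show "\<forall>\<^sub>F v in at 0. norm (stress (Re (z + v)) (Im (z + v)) - stress ?p ?q) \<le> \<bar>?f v\<bar> + \<bar>?g v\<bar>"
      unfolding eventually_at using r(1) by blast
  qed
  then show "isCont (\<lambda>z. stress (Re z) (Im z)) z"
    unfolding isCont_iff by (simp add: LIM_zero_iff)
qed

definition stress_peak :: "real \<Rightarrow> real \<Rightarrow> bool" where
  "stress_peak p q \<longleftrightarrow> (\<forall>p' q'. stress p' q' \<le> stress p q)"

lemma stress_peak_exists:
  assumes "0 < stress p0 q0"
  shows "\<exists>p q. stress_peak p q \<and> 0 < stress p q"
proof -
  let ?B = "cbox (Complex (- \<bar>K\<bar>) (- \<bar>K\<bar>)) (Complex \<bar>K\<bar> \<bar>K\<bar>)"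
  have out: "stress p q = 0" if "Complex p q \<notin> ?B" for p q
  proof -
    have "K \<le> \<bar>p\<bar> \<or> q < - \<bar>K\<bar> \<or> \<bar>K\<bar> \<le> q"
      using that by (auto simp: in_cbox_complex_iff)
    then show ?thesis using stress_outside_strip stress_above stress_below by blast
  qed
  have "Complex p0 q0 \<in> ?B" using out[of p0 q0] assms by auto
  then obtain z where z: "z \<in> ?B" "\<And>y. y \<in> ?B \<Longrightarrow> stress (Re y) (Im y) \<le> stress (Re z) (Im z)"
    using continuous_attains_sup[OF compact_cbox _ continuous_on_subset[OF stress_continuous subset_UNIV]]
    by blast
  have pos: "0 < stress (Re z) (Im z)" using z(2)[OF \<open>Complex p0 q0 \<in> ?B\<close>] assms by simp
  moreover have "stress p q \<le> stress (Re z) (Im z)" for p q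
    using z(2)[of "Complex p q"] out[of p q] pos by (cases "Complex p q \<in> ?B") auto
  ultimately show ?thesis unfolding stress_peak_def by blast
qed

text \<open>The slopes in the directions east, north-east, north, west, south-west and south, in this order.\<close>
lemma stress_peak_slopes:
  assumes "stress_peak p q"
  defines "a \<equiv> tail_weight (E p) q" and "b \<equiv> tail_weight (NE p) q"
  shows "b + NE p q \<le> 0" "0 \<le> a" "0 \<le> a + b" "N p q \<le> b" "a + N p q + W p q \<le> 0"
    "E p q + NE p q + a + b \<le> 0"
proof -
  obtain r where r: "r > 0" "\<And>s t. \<bar>s\<bar> < r \<Longrightarrow> \<bar>t\<bar> < r \<Longrightarrow>
      stress (p + s) (q + t) = stress p q
       + (if 0 \<le> s then
            of_int (E p q) * max 0 (- t) + of_int (NE p q) * max 0 (s - t)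
            - t * of_int a + (s - t) * of_int b
          else
            of_int (W p q) * max 0 (- t) + of_int (SW p q) * max 0 (s - t)
            - t * of_int (a + N p q) + (s - t) * of_int (b - N p q))"
    using stress_local[of p q] unfolding a_def b_def by blast
  define d where "d = r / 2"
  have d: "d > 0" "\<bar>d\<bar> < r" "\<bar>- d\<bar> < r" "\<bar>0\<bar> < r" using r(1) by (auto simp: d_def)
  have le: "stress (p + s) (q + t) \<le> stress p q" for s t using assms(1) by (simp add: stress_peak_def)
  have scale: "k \<le> 0" if "d * of_int k \<le> 0" for k :: int
    using that d(1) by (simp add: mult_le_0_iff)
  show "b + NE p q \<le> 0"
    by (rule scale) (use le[of d 0] r(2)[OF d(2,4)] d(1) in \<open>simp add: algebra_simps\<close>)
  have "- a \<le> 0"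
    by (rule scale) (use le[of d d] r(2)[OF d(2,2)] d(1) in \<open>simp add: algebra_simps\<close>)
  then show "0 \<le> a" by simp
  have "- a - b \<le> 0"
    by (rule scale) (use le[of 0 d] r(2)[OF d(4,2)] d(1) in \<open>simp add: algebra_simps max_def\<close>)
  then show "0 \<le> a + b" by simp
  have "stress (p - d) q = stress p q + d * of_int (N p q) - d * of_int b"
    using r(2)[OF d(3,4)] d(1) by (simp add: algebra_simps)
  then have "d * of_int (N p q) \<le> d * of_int b"
    using le[of "- d" 0] by simp
  then show "N p q \<le> b" using d(1) by simp
  show "a + N p q + W p q \<le> 0"
    by (rule scale) (use le[of "- d" "- d"] r(2)[OF d(3,3)] d(1) in \<open>simp add: algebra_simps\<close>)
  show "E p q + NE p q + a + b \<le> 0"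
    by (rule scale) (use le[of 0 "- d"] r(2)[OF d(4,3)] d(1) in \<open>simp add: algebra_simps\<close>)
qed

text \<open>All creases at such a point are convex, and a convex function is constant near a maximum.\<close>
lemma stress_peak_flat_where_nonnegative:
  assumes "stress_peak p q" "0 \<le> E p q" "0 \<le> NE p q" "0 \<le> N p q" "0 \<le> W p q" "0 \<le> SW p q" "0 \<le> S p q"
  shows "\<exists>r>0. \<forall>s t. \<bar>s\<bar> < r \<longrightarrow> \<bar>t\<bar> < r \<longrightarrow> stress (p + s) (q + t) = stress p q"
proof (rule stress_near_constant)
  note slopes = stress_peak_slopes[OF assms(1)] and nonneg = assms(2-)
  show "tail_weight (E p) q = 0" "tail_weight (NE p) q = 0" "E p q = 0" "NE p q = 0" "N p q = 0" "W p q = 0"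
    using slopes nonneg by linarith+
  then show "SW p q = 0" using balance[of p q] nonneg by linarith
qed

text \<open>The field can be recovered from the stress function, whose creases it records.\<close>
lemma stress_zero_imp_field_zero:
  assumes "\<And>p q. stress p q = 0"
  shows "E p q = 0 \<and> NE p q = 0 \<and> N p q = 0 \<and> W p q = 0 \<and> SW p q = 0 \<and> S p q = 0"
proof -
  obtain r where r: "r > 0" "\<And>s t. \<bar>s\<bar> < r \<Longrightarrow> \<bar>t\<bar> < r \<Longrightarrow>
      (if 0 \<le> s then
            of_int (E p q) * max 0 (- t) + of_int (NE p q) * max 0 (s - t)
            - t * of_int (tail_weight (E p) q) + (s - t) * of_int (tail_weight (NE p) q)
          else
            of_int (W p q) * max 0 (- t) + of_int (SW p q) * max 0 (s - t)
            - t * of_int (tail_weight (E p) q + N p q) + (s - t) * of_int (tail_weight (NE p) q - N p q)) = (0::real)"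
    using stress_local[of p q] unfolding assms by auto
  define d where "d = r / 2"
  have d: "d > 0" "\<bar>d\<bar> < r" "\<bar>- d\<bar> < r" "\<bar>0\<bar> < r" using r(1) by (auto simp: d_def)
  have "tail_weight (E p) q = 0" using r(2)[OF d(2,2)] d(1) by simp
  moreover have "tail_weight (NE p) q = 0" using calculation r(2)[OF d(4,2)] d(1) by (simp add: max_def)
  ultimately show ?thesis
    using r(2)[OF d(2,4)] r(2)[OF d(3,4)] r(2)[OF d(3,3)] r(2)[OF d(4,3)] d(1) balance[of p q]
    by (simp add: max_def)
qed

text \<open>Two neighbouring slopes that vanish make the function constant on the sector between the two
  directions.\<close>
lemma stress_peak_flat_sector:
  assumes "stress_peak p q"
  shows "\<exists>s t e. 0 < e \<and> (\<forall>s' t'. \<bar>s' - s\<bar> < e \<longrightarrow> \<bar>t' - t\<bar> < e \<longrightarrow> stress s' t' = stress p q)"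
proof -
  let ?a = "tail_weight (E p) q" and ?b = "tail_weight (NE p) q"
  obtain r where r: "r > 0" "\<And>s t. \<bar>s\<bar> < r \<Longrightarrow> \<bar>t\<bar> < r \<Longrightarrow>
      stress (p + s) (q + t) = stress p q
       + (if 0 \<le> s then
            of_int (E p q) * max 0 (- t) + of_int (NE p q) * max 0 (s - t)
            - t * of_int ?a + (s - t) * of_int ?b
          else
            of_int (W p q) * max 0 (- t) + of_int (SW p q) * max 0 (s - t)
            - t * of_int (?a + N p q) + (s - t) * of_int (?b - N p q))"
    using stress_local[of p q] by blast
  define d where "d = r / 4"
  have d: "d > 0" "4 * d = r" using r(1) by (auto simp: d_def)
  have box: ?thesis if "\<bar>s\<bar> \<le> 2 * d" "\<bar>t\<bar> \<le> 2 * d" "\<And>s' t'. \<bar>s' - s\<bar> < d / 2 \<Longrightarrow> \<bar>t' - t\<bar> < d / 2 \<Longrightarrow>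
     \<bar>s'\<bar> < r \<Longrightarrow> \<bar>t'\<bar> < r \<Longrightarrow> stress (p + s') (q + t') = stress p q" for s t
  proof (rule exI[of _ "p + s"], rule exI[of _ "q + t"], rule exI[of _ "d / 2"], intro conjI allI impI)
    fix s' t' assume *: "\<bar>s' - (p + s)\<bar> < d / 2" "\<bar>t' - (q + t)\<bar> < d / 2"
    have "\<bar>s' - p\<bar> < r" "\<bar>t' - q\<bar> < r" "\<bar>(s' - p) - s\<bar> < d / 2" "\<bar>(t' - q) - t\<bar> < d / 2"
      using * that(1,2) d by linarith+
    then show "stress s' t' = stress p q" using that(3)[of "s' - p" "t' - q"] by simp
  qed (use d in auto)
  note slopes = stress_peak_slopes[OF assms] and bal = balance(1)[of p q]
  have "?b + NE p q = 0 \<and> ?a = 0 \<or> ?a = 0 \<and> ?b = 0 \<or> ?a + ?b = 0 \<and> ?b = N p q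
      \<or> ?b = N p q \<and> ?a + N p q + W p q = 0 \<or> ?a + N p q + W p q = 0 \<and> E p q + NE p q + ?a + ?b = 0
      \<or> E p q + NE p q + ?a + ?b = 0 \<and> ?b + NE p q = 0"
    using shape[of p q] slopes by (rule adjacent_flat_slopes)
  then show ?thesis
  proof (elim disjE conjE)
    assume h: "?b + NE p q = 0" "?a = 0"
    have h': "?b = - NE p q" using h by linarith+
    show ?thesis
    proof (rule box[of "2 * d" "d"])
      fix s' t' assume *: "\<bar>s' - (2 * d)\<bar> < d / 2" "\<bar>t' - (d)\<bar> < d / 2" "\<bar>s'\<bar> < r" "\<bar>t'\<bar> < r"
      have "0 < t'" "t' < s'" using *(1,2) d(1) by linarith+
      then show "stress (p + s') (q + t') = stress p q"
        using r(2)[OF *(3,4)] h' h by (simp add: max_def algebra_simps)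
    qed (use d(1) in auto)
  next
    assume h: "?a = 0" "?b = 0"
    show ?thesis
    proof (rule box[of "d" "2 * d"])
      fix s' t' assume *: "\<bar>s' - (d)\<bar> < d / 2" "\<bar>t' - (2 * d)\<bar> < d / 2" "\<bar>s'\<bar> < r" "\<bar>t'\<bar> < r"
      have "0 < s'" "s' < t'" using *(1,2) d(1) by linarith+
      then show "stress (p + s') (q + t') = stress p q"
        using r(2)[OF *(3,4)]  h by (simp add: max_def algebra_simps)
    qed (use d(1) in auto)
  next
    assume h: "?a + ?b = 0" "?b = N p q"
    have h': "?a = - N p q" using h by linarith+
    show ?thesis
    proof (rule box[of "- d" "d"])
      fix s' t' assume *: "\<bar>s' - (- d)\<bar> < d / 2" "\<bar>t' - (d)\<bar> < d / 2" "\<bar>s'\<bar> < r" "\<bar>t'\<bar> < r"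
      have "s' < 0" "0 < t'" using *(1,2) d(1) by linarith+
      then show "stress (p + s') (q + t') = stress p q"
        using r(2)[OF *(3,4)] h' h by (simp add: max_def algebra_simps)
    qed (use d(1) in auto)
  next
    assume h: "?b = N p q" "?a + N p q + W p q = 0"
    have h': "?a = - W p q - N p q" using h by linarith+
    show ?thesis
    proof (rule box[of "- 2 * d" "- d"])
      fix s' t' assume *: "\<bar>s' - (- 2 * d)\<bar> < d / 2" "\<bar>t' - (- d)\<bar> < d / 2" "\<bar>s'\<bar> < r" "\<bar>t'\<bar> < r"
      have "s' < t'" "t' < 0" using *(1,2) d(1) by linarith+
      then show "stress (p + s') (q + t') = stress p q"
        using r(2)[OF *(3,4)] h' h by (simp add: max_def algebra_simps)
    qed (use d(1) in auto)
  next
    assume h: "?a + N p q + W p q = 0" "E p q + NE p q + ?a + ?b = 0"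
    have h': "?a = - W p q - N p q" "?b = N p q - SW p q" using h bal by linarith+
    show ?thesis
    proof (rule box[of "- d" "- 2 * d"])
      fix s' t' assume *: "\<bar>s' - (- d)\<bar> < d / 2" "\<bar>t' - (- 2 * d)\<bar> < d / 2" "\<bar>s'\<bar> < r" "\<bar>t'\<bar> < r"
      have "t' < s'" "s' < 0" using *(1,2) d(1) by linarith+
      then show "stress (p + s') (q + t') = stress p q"
        using r(2)[OF *(3,4)] h' h by (simp add: max_def algebra_simps)
    qed (use d(1) in auto)
  next
    assume h: "E p q + NE p q + ?a + ?b = 0" "?b + NE p q = 0"
    have h': "?b = - NE p q" "?a = - E p q" using h by linarith+
    show ?thesis
    proof (rule box[of "d" "- d"])
      fix s' t' assume *: "\<bar>s' - (d)\<bar> < d / 2" "\<bar>t' - (- d)\<bar> < d / 2" "\<bar>s'\<bar> < r" "\<bar>t'\<bar> < r"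
      have "t' < 0" "0 < s'" using *(1,2) d(1) by linarith+
      then show "stress (p + s') (q + t') = stress p q"
        using r(2)[OF *(3,4)] h' h by (simp add: max_def algebra_simps)
    qed (use d(1) in auto)
  qed
qed

end

section \<open>Hexagonal coordinates\<close>

text \<open>The other two vectors of a unit tripod are \<open>c\<close> rotated by 120 degrees in both senses: their
  component along \<open>c\<close> is \<open>-1/2\<close>, and the orthogonal component \<open>m\<close> is determined up to sign.\<close>
lemma unit_tripod_unique:
  fixes c v w v' w' :: "real^2"
  assumes "norm c = 1" "norm v = 1" "norm w = 1" "norm v' = 1" "norm w' = 1"
    and "c + v + w = 0" "c + v' + w' = 0"
  shows "{v, w} = {v', w'}"
proof -
  have ww: "w = - c - v" "w' = - c - v'" using assms(6,7) by (simp_all add: algebra_simps add_eq_0_iff)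
  have sq: "(u $ 1)\<^sup>2 + (u $ 2)\<^sup>2 = 1" if "norm u = 1" for u :: "real^2"
    using that by (simp add: norm_eq_1 inner_vec_def sum_2 power2_eq_square)
  note sqs = sq[OF assms(1)] sq[OF assms(2)] sq[OF assms(3)] sq[OF assms(4)] sq[OF assms(5)]
  define m where "m u = c $ 1 * u $ 2 - c $ 2 * u $ 1" for u :: "real^2"
  have half: "c $ 1 * u $ 1 + c $ 2 * u $ 2 = - 1 / 2 \<and> (m u)\<^sup>2 = 3 / 4" if "u \<in> {v, v'}" for u
  proof -
    have "(- c $ 1 - u $ 1)\<^sup>2 + (- c $ 2 - u $ 2)\<^sup>2 = 1" "(u $ 1)\<^sup>2 + (u $ 2)\<^sup>2 = 1"
      using sqs that ww by auto
    then have d: "c $ 1 * u $ 1 + c $ 2 * u $ 2 = - 1 / 2" using sqs(1) by (simp add: power2_eq_square algebra_simps)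
    have "(m u)\<^sup>2 + (c $ 1 * u $ 1 + c $ 2 * u $ 2)\<^sup>2 = ((c $ 1)\<^sup>2 + (c $ 2)\<^sup>2) * ((u $ 1)\<^sup>2 + (u $ 2)\<^sup>2)"
      by (simp add: m_def power2_eq_square algebra_simps)
    then show ?thesis using d sqs(1) \<open>(u $ 1)\<^sup>2 + (u $ 2)\<^sup>2 = 1\<close> by (simp add: power2_eq_square)
  qed
  have expand: "u $ 1 = - c $ 1 / 2 - m u * c $ 2 \<and> u $ 2 = - c $ 2 / 2 + m u * c $ 1" if "u \<in> {v, v'}" for u
  proof -
    have d: "c $ 1 * u $ 1 + c $ 2 * u $ 2 = - 1 / 2" using half[OF that] by blast
    have "u $ 1 * ((c $ 1)\<^sup>2 + (c $ 2)\<^sup>2) = (c $ 1 * u $ 1 + c $ 2 * u $ 2) * c $ 1 - m u * c $ 2"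
      "u $ 2 * ((c $ 1)\<^sup>2 + (c $ 2)\<^sup>2) = (c $ 1 * u $ 1 + c $ 2 * u $ 2) * c $ 2 + m u * c $ 1"
      by (simp_all add: m_def power2_eq_square algebra_simps)
    then show ?thesis unfolding sqs(1) d by simp
  qed
  have ev: "v $ 1 = - c $ 1 / 2 - m v * c $ 2" "v $ 2 = - c $ 2 / 2 + m v * c $ 1"
    and ev': "v' $ 1 = - c $ 1 / 2 - m v' * c $ 2" "v' $ 2 = - c $ 2 / 2 + m v' * c $ 1"
    using expand by blast+
  have "(m v)\<^sup>2 = 3 / 4" "(m v')\<^sup>2 = 3 / 4" using half by blast+
  then have "(m v')\<^sup>2 = (m v)\<^sup>2" by (simp only:)
  then consider "m v' = m v" | "m v' = - m v" by (metis power2_eq_iff)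
  then show ?thesis
  proof cases
    case 1
    have "v' $ 1 = v $ 1" "v' $ 2 = v $ 2" by (simp_all only: ev ev' 1)
    then have "v' = v" by (simp only: vec_eq_iff forall_2)
    moreover from this have "w' = w" by (simp only: ww)
    ultimately show ?thesis by simp
  next
    case 2
    have "v' $ 1 = w $ 1" "v' $ 2 = w $ 2"
      unfolding ww(1) vector_minus_component vector_uminus_component ev ev' 2 by simp_all
    then have "v' = w" by (simp only: vec_eq_iff forall_2)
    moreover from this have "w' = v" using ww by simp
    ultimately show ?thesis by (simp add: insert_commute)
  qed
qed

text \<open>Two unit vectors at 120 degrees. In the coordinates with respect to this basis the six vectors of the
  hexagon are the lattice points of \<open>compass\<close>. Complex numbers serve as the coordinate plane.\<close>
locale hexagonal_frame =
  fixes e0 e2 :: "real^2"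
  assumes frame: "norm e0 = 1" "norm e2 = 1" "e0 \<bullet> e2 = - 1 / 2"
begin

definition point :: "complex \<Rightarrow> real^2" where
  "point z = Re z *\<^sub>R e0 + Im z *\<^sub>R e2"

definition coords :: "real^2 \<Rightarrow> complex" where
  "coords v = Complex (4 / 3 * (v \<bullet> e0 + v \<bullet> e2 / 2)) (4 / 3 * (v \<bullet> e2 + v \<bullet> e0 / 2))"

lemma frame_inner: "e0 \<bullet> e0 = 1" "e2 \<bullet> e2 = 1" "e2 \<bullet> e0 = - 1 / 2"
  using frame by (simp_all add: dot_square_norm inner_commute)

lemma coords_point [simp]: "coords (point z) = z"
  by (simp add: coords_def point_def complex_eq_iff inner_add_left frame_inner frame(3) field_simps)

lemma point_coords [simp]: "point (coords v) = v"
proof -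
  define d where "d = v - point (coords v)"
  have "d \<bullet> e0 = 0" "d \<bullet> e2 = 0"
    by (simp_all add: d_def coords_def point_def inner_diff_left inner_add_left frame_inner frame(3) field_simps)
  then have d: "d $ 1 * e0 $ 1 + d $ 2 * e0 $ 2 = 0" "d $ 1 * e2 $ 1 + d $ 2 * e2 $ 2 = 0"
    by (simp_all add: inner_vec_def sum_2)
  define D where "D = e0 $ 1 * e2 $ 2 - e0 $ 2 * e2 $ 1"
  have "D\<^sup>2 + (e0 \<bullet> e2)\<^sup>2 = (e0 \<bullet> e0) * (e2 \<bullet> e2)"
    by (simp add: D_def inner_vec_def sum_2 power2_eq_square algebra_simps)
  then have "D \<noteq> 0" using frame_inner frame(3) by (auto simp: power2_eq_square)
  moreover have "d $ 1 * D = (d $ 1 * e0 $ 1 + d $ 2 * e0 $ 2) * e2 $ 2 - (d $ 1 * e2 $ 1 + d $ 2 * e2 $ 2) * e0 $ 2"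
    "d $ 2 * D = (d $ 1 * e2 $ 1 + d $ 2 * e2 $ 2) * e0 $ 1 - (d $ 1 * e0 $ 1 + d $ 2 * e0 $ 2) * e2 $ 1"
    by (simp_all add: D_def algebra_simps)
  ultimately have "d $ 1 = 0" "d $ 2 = 0" unfolding d by simp_all
  then have "d = 0" by (simp add: vec_eq_iff forall_2)
  then show ?thesis by (simp add: d_def)
qed

lemma point_eq_iff [simp]: "point z = point z' \<longleftrightarrow> z = z'"
  by (metis coords_point)

lemma point_add: "point (z + z') = point z + point z'"
  and point_scaleR: "point (k *\<^sub>R z) = k *\<^sub>R point z"
  and point_minus: "point (- z) = - point z"
  and point_zero [simp]: "point 0 = 0"
  by (simp_all add: point_def algebra_simps)

lemma linear_coords: "linear coords"
  by (rule linearI) (simp_all add: coords_def complex_eq_iff inner_add_left algebra_simps)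

lemma linear_point: "linear point"
  by (rule linearI) (simp_all add: point_add point_scaleR)

definition compass :: "complex set" where
  "compass = {1, Complex 1 1, \<i>, - 1, - Complex 1 1, - \<i>}"

lemma norm_compass: "d \<in> compass \<Longrightarrow> norm (point d) = 1"
proof -
  assume "d \<in> compass"
  then have "point d \<bullet> point d = 1"
    by (auto simp: compass_def point_def inner_add_left inner_add_right inner_diff_left inner_diff_right
        frame_inner frame(3))
  then show ?thesis by (simp add: norm_eq_1)
qed

lemma sgn_point_compass:
  assumes "d \<in> compass"
  shows "sgn (point v) = point d \<longleftrightarrow> (\<exists>k>0. v = k *\<^sub>R d)"
proof
  assume *: "sgn (point v) = point d"
  then have "point v \<noteq> 0" using norm_compass[OF assms] by auto
  then have "point v = point (norm (point v) *\<^sub>R d)"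
    by (simp add: point_scaleR flip: *) (simp add: sgn_div_norm)
  then show "\<exists>k>0. v = k *\<^sub>R d" using \<open>point v \<noteq> 0\<close> unfolding point_eq_iff
    by (intro exI[of _ "norm (point v)"]) auto
next
  assume "\<exists>k>0. v = k *\<^sub>R d"
  then show "sgn (point v) = point d"
    using norm_compass[OF assms] by (auto simp: point_scaleR sgn_ray)
qed

definition edge_at :: "(real^2) set \<Rightarrow> complex \<Rightarrow> complex \<Rightarrow> int" where
  "edge_at S d z = of_bool (point d \<in> directions S (point z))"

text \<open>Nearby the network consists of rays, and on a ray just the two directions parallel to it occur. So a
  lattice direction can occur only on the two rays that are parallel to it.\<close>
lemma edge_at_near:
  assumes star: "star_radius S (point z) r" and fin: "finite (directions S (point z))"
    and d: "d \<in> compass" and v: "v \<noteq> 0" "norm (point v) < r"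
  shows "edge_at S d (z + v) =
    (if \<exists>k>0. v = k *\<^sub>R d then edge_at S d z else if \<exists>k>0. v = k *\<^sub>R (- d) then edge_at S (- d) z else 0)"
proof -
  have nz: "point v \<noteq> 0" using v(1) point_eq_iff[of v 0] by simp
  have pz: "point (z + v) = point z + norm (point v) *\<^sub>R sgn (point v)"
    using nz by (simp add: point_add sgn_div_norm)
  have dirs: "directions S (point (z + v)) =
      (if sgn (point v) \<in> directions S (point z) then {sgn (point v), - sgn (point v)} else {})"
  proof (cases "sgn (point v) \<in> directions S (point z)")
    case True
    then show ?thesis unfolding pz using directions_on_ray[OF star fin True] nz v(2) by simp
  next
    case False
    then show ?thesis using directions_off_rays[OF star, of "point (z + v)"] nz v(2)
      by (simp add: point_add dist_norm)
  qed
  have d': "- d \<in> compass" using d by (auto simp: compass_def)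
  have eq: "sgn (point v) = point d \<longleftrightarrow> (\<exists>k>0. v = k *\<^sub>R d)"
    "point d = - sgn (point v) \<longleftrightarrow> (\<exists>k>0. v = k *\<^sub>R (- d))"
    using sgn_point_compass[OF d, of v] sgn_point_compass[OF d', of v]
    by (auto simp: point_minus)
  show ?thesis
    unfolding edge_at_def dirs eq(1)[symmetric] eq(2)[symmetric] by (auto simp: point_minus)
qed

text \<open>A balanced set that contains one of the six lattice directions is the line or the tripod through
  it, hence lies within the lattice directions entirely. The three directions of the tripod arise from
  \<open>d\<close> by the rotation by 120 degrees, which in these coordinates takes \<open>Complex a b\<close> to
  \<open>Complex (- b) (a - b)\<close>.\<close>
lemma balanced_directions_star:
  assumes bal: "balanced_directions U" and unit: "\<And>u. u \<in> U \<Longrightarrow> norm u = 1"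
  shows "(of_bool (point 1 \<in> U), of_bool (point (Complex 1 1) \<in> U), of_bool (point \<i> \<in> U),
      of_bool (point (- 1) \<in> U), of_bool (point (- Complex 1 1) \<in> U), of_bool (point (- \<i>) \<in> U)) \<in> balanced_stars"
proof (cases "\<exists>d\<in>compass. point d \<in> U")
  case False
  then show ?thesis by (auto simp: compass_def balanced_stars_def)
next
  case True
  then obtain d where d: "d \<in> compass" "point d \<in> U" by blast
  define d1 where "d1 = Complex (- Im d) (Re d - Im d)"
  define d2 where "d2 = Complex (Im d - Re d) (- Re d)"
  have d12: "d1 \<in> compass" "d2 \<in> compass" "d + d1 + d2 = 0"
    using d(1) unfolding compass_def insert_iff empty_iff d1_def d2_def
    by (elim disjE; simp add: complex_eq_iff)+
  have sum0: "point d + point d1 + point d2 = 0" using d12(3) by (metis point_add point_zero)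
  have "U = {point d, - point d} \<or> U = {point d, point d1, point d2}"
    using bal unfolding balanced_directions_def
  proof (elim disjE exE conjE)
    fix u v w assume U: "U = {u, v, w}" "u + v + w = 0"
    have perm: "U = {v, u, w} \<and> v + u + w = 0" "U = {w, u, v} \<and> w + u + v = 0"
      using U by (auto simp: ac_simps)
    consider "point d = u" | "point d = v" | "point d = w" using d(2) U(1) by blast
    then have "\<exists>v' w'. U = {point d, v', w'} \<and> point d + v' + w' = 0"
      using U perm by cases blast+
    then obtain v' w' where *: "U = {point d, v', w'}" "point d + v' + w' = 0" by blast
    then have "{v', w'} = {point d1, point d2}"
      using unit norm_compass d d12(1,2) sum0 by (intro unit_tripod_unique[of "point d"]) auto
    then show ?thesis using *(1) by auto
  qed (use d(2) in auto)
  then have disj: "U = {point d, point (- d)} \<or> U = {point d, point d1, point d2}" by (simp add: point_minus)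
  consider "d = 1" | "d = Complex 1 1" | "d = \<i>" | "d = - 1" | "d = - Complex 1 1" | "d = - \<i>"
    using d(1) by (auto simp: compass_def)
  then show ?thesis
  proof cases
    case 1
    show ?thesis using disj unfolding 1 d1_def d2_def by (elim disjE) (simp_all add: complex_eq_iff balanced_stars_def)
  next
    case 2
    show ?thesis using disj unfolding 2 d1_def d2_def by (elim disjE) (simp_all add: complex_eq_iff balanced_stars_def)
  next
    case 3
    show ?thesis using disj unfolding 3 d1_def d2_def by (elim disjE) (simp_all add: complex_eq_iff balanced_stars_def)
  next
    case 4
    show ?thesis using disj unfolding 4 d1_def d2_def by (elim disjE) (simp_all add: complex_eq_iff balanced_stars_def)
  next
    case 5
    show ?thesis using disj unfolding 5 d1_def d2_def by (elim disjE) (simp_all add: complex_eq_iff balanced_stars_def)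
  next
    case 6
    show ?thesis using disj unfolding 6 d1_def d2_def by (elim disjE) (simp_all add: complex_eq_iff balanced_stars_def)
  qed
qed

lemma acyclic_network_nonseparating:
  assumes "finite_union_of_segments S" "no_closed_loop S"
  shows "connected (- (coords ` S))" "closed (coords ` S)" "interior (coords ` S) = {}" "bounded (coords ` S)"
proof -
  obtain F where F: "finite F" "S = (\<Union>(a, b)\<in>F. closed_segment a b)"
    using assms(1) by (auto simp: finite_union_of_segments_def)
  define F' where "F' = (\<lambda>(a, b). (coords a, coords b)) ` F"
  have seg: "coords ` closed_segment a b = closed_segment (coords a) (coords b)" for a b
    by (rule closed_segment_linear_image[OF linear_coords, symmetric])
  have S': "coords ` S = (\<Union>(a, b)\<in>F'. closed_segment a b)"
    unfolding F(2) F'_def by (auto simp: image_UN case_prod_beta seg)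
  have fin: "finite F'" using F(1) by (simp add: F'_def)
  have compact: "compact (coords ` S)" unfolding S' using fin by (intro compact_UN) auto
  then show "closed (coords ` S)" "bounded (coords ` S)" by (simp_all add: compact_imp_closed compact_imp_bounded)
  have "negligible (closed_segment a b)" for a b :: complex
    by (simp add: negligible_convex_interior interior_closed_segment_ge2)
  then have "negligible (coords ` S)"
    unfolding S' using fin by (intro negligible_Union) auto
  then show "interior (coords ` S) = {}"
    by (meson interior_subset negligible_subset open_interior open_not_negligible)
  have "\<nexists>g. simple_path g \<and> pathfinish g = pathstart g \<and> path_image g \<subseteq> coords ` S"
  proof
    assume "\<exists>g. simple_path g \<and> pathfinish g = pathstart g \<and> path_image g \<subseteq> coords ` S"
    then obtain g where g: "simple_path g" "pathfinish g = pathstart g" "path_image g \<subseteq> coords ` S" by blast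
    have "inj point" by (simp add: inj_on_def)
    then have h: "simple_path (point \<circ> g)" "pathfinish (point \<circ> g) = pathstart (point \<circ> g)"
      using g(1,2) simple_path_linear_image_eq[OF linear_point] by (simp_all add: pathfinish_compose pathstart_compose)
    have "path_image (point \<circ> g) \<subseteq> S" using g(3) by (force simp: path_image_compose)
    moreover have "path_image (point \<circ> g) homeomorphic sphere (0 :: complex) 1"
      using h by (rule homeomorphic_simple_path_image_circle) simp
    moreover have "sphere (0 :: complex) 1 homeomorphic sphere (0 :: real^2) 1"
      by (rule homeomorphic_spheres_gen) auto
    ultimately show False using assms(2) unfolding no_closed_loop_def by (meson homeomorphic_trans)
  qed
  then show "connected (- (coords ` S))"
    unfolding S' using fin by (intro acyclic_segments_nonseparating)
qed

end

section \<open>Comparing two networks\<close>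

text \<open>The last assumption is what codirected locally minimal trees satisfy: the first alternative holds at
  terminals, the second one elsewhere.\<close>
locale codirected_networks = hexagonal_frame +
  fixes A B :: "(real^2) set"
  assumes segments: "finite_union_of_segments A" "finite_union_of_segments B"
    and acyclic: "no_closed_loop A" "no_closed_loop B"
    and local: "directions A x = directions B x \<or>
        balanced_directions (directions A x) \<and> balanced_directions (directions B x)"
begin

definition excess :: "complex \<Rightarrow> complex \<Rightarrow> int" where
  "excess d z = edge_at A d z - edge_at B d z"

lemma excess_near:
  "\<exists>r>0. \<forall>v d. v \<noteq> 0 \<longrightarrow> norm v < r \<longrightarrow> d \<in> compass \<longrightarrow> excess d (z + v) =
    (if \<exists>k>0. v = k *\<^sub>R d then excess d z else if \<exists>k>0. v = k *\<^sub>R (- d) then excess (- d) z else 0)"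
proof -
  obtain rA rB where r: "star_radius A (point z) rA" "star_radius B (point z) rB"
    using star_radius_exists[OF segments(1)] star_radius_exists[OF segments(2)] by blast
  define r where "r = min rA rB"
  have r0: "0 < r" using r by (simp add: r_def star_radius_def)
  have small: "norm (point v) \<le> 2 * norm v" for v
  proof -
    have "norm (point v) \<le> norm (Re v *\<^sub>R e0) + norm (Im v *\<^sub>R e2)" unfolding point_def by (rule norm_triangle_ineq)
    also have "\<dots> \<le> 2 * norm v" using frame abs_Re_le_cmod[of v] abs_Im_le_cmod[of v] by simp
    finally show ?thesis .
  qed
  have "excess d (z + v) =
    (if \<exists>k>0. v = k *\<^sub>R d then excess d z else if \<exists>k>0. v = k *\<^sub>R (- d) then excess (- d) z else 0)"
    if "v \<noteq> 0" "norm v < r / 2" "d \<in> compass" for v d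
  proof -
    have "norm (point v) < rA" "norm (point v) < rB" using small[of v] that(2) by (auto simp: r_def)
    note near = edge_at_near[OF r(1) star_radius_exists(2)[OF segments(1)] that(3,1) this(1)]
      edge_at_near[OF r(2) star_radius_exists(2)[OF segments(2)] that(3,1) this(2)]
    have "(if P then a else if Q then b else 0) - (if P then c else if Q then d else 0)
        = (if P then a - c else if Q then b - d else 0)" for P Q and a b c d :: int by simp
    then show ?thesis unfolding excess_def near .
  qed
  then show ?thesis using r0 by (intro exI[of _ "r / 2"]) auto
qed

lemma excess_balanced:
  "\<exists>x\<in>balanced_stars. \<exists>y\<in>balanced_stars.
     (excess 1 z, excess (Complex 1 1) z, excess \<i> z, excess (- 1) z, excess (- Complex 1 1) z, excess (- \<i>) z) = x - y"
proof -
  have unit: "norm u = 1" if "u \<in> directions S x" for u :: "real^2" and S x using that by (simp add: directions_def)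
  show ?thesis
    using local[of "point z"]
  proof
    assume "directions A (point z) = directions B (point z)"
    then show ?thesis by (intro bexI[of _ 0]) (auto simp: excess_def edge_at_def zero_prod_def balanced_stars_def)
  next
    assume "balanced_directions (directions A (point z)) \<and> balanced_directions (directions B (point z))"
    then have bal: "balanced_directions (directions A (point z))" "balanced_directions (directions B (point z))"
      by blast+
    show ?thesis
      by (rule bexI[OF bexI[OF _ balanced_directions_star[OF bal(2) unit]] balanced_directions_star[OF bal(1) unit]])
        (simp_all add: excess_def edge_at_def)
  qed
qed

lemma compass_rays:
  "(\<exists>k>0. Complex s t = k *\<^sub>R 1) \<longleftrightarrow> t = 0 \<and> 0 < s"
  "(\<exists>k>0. Complex s t = k *\<^sub>R (- 1)) \<longleftrightarrow> t = 0 \<and> s < 0"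
  "(\<exists>k>0. Complex s t = k *\<^sub>R Complex 1 1) \<longleftrightarrow> s = t \<and> 0 < s"
  "(\<exists>k>0. Complex s t = k *\<^sub>R (- Complex 1 1)) \<longleftrightarrow> s = t \<and> s < 0"
  "(\<exists>k>0. Complex s t = k *\<^sub>R \<i>) \<longleftrightarrow> s = 0 \<and> 0 < t"
  "(\<exists>k>0. Complex s t = k *\<^sub>R (- \<i>)) \<longleftrightarrow> s = 0 \<and> t < 0"
  by (auto simp: complex_eq_iff intro: exI[of _ "- s"] exI[of _ "- t"])

abbreviation field_at :: "complex \<Rightarrow> real \<Rightarrow> real \<Rightarrow> int" where
  "field_at d \<equiv> \<lambda>p q. excess d (Complex p q)"

abbreviation lattice_field :: "real \<Rightarrow> bool" where
  "lattice_field \<equiv> balanced_lattice_field (field_at 1) (field_at (Complex 1 1)) (field_at \<i>)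
     (field_at (- 1)) (field_at (- Complex 1 1)) (field_at (- \<i>))"

abbreviation excess_stress :: "real \<Rightarrow> real \<Rightarrow> real" where
  "excess_stress \<equiv> balanced_lattice_field.stress (field_at 1) (field_at (Complex 1 1))"

lemma bounding_box:
  "\<exists>K. \<forall>z. K \<le> \<bar>Re z\<bar> \<or> K \<le> \<bar>Im z\<bar> \<longrightarrow> z \<notin> coords ` A \<and> z \<notin> coords ` B"
proof -
  have "bounded (coords ` A \<union> coords ` B)"
    using acyclic_network_nonseparating(4)[OF segments(1) acyclic(1)]
      acyclic_network_nonseparating(4)[OF segments(2) acyclic(2)] by simp
  then obtain c where c: "\<And>z. z \<in> coords ` A \<union> coords ` B \<Longrightarrow> norm z \<le> c" by (auto simp: bounded_iff)
  have "z \<notin> coords ` A \<and> z \<notin> coords ` B" if "c + 1 \<le> \<bar>Re z\<bar> \<or> c + 1 \<le> \<bar>Im z\<bar>" for z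
  proof -
    have "\<not> norm z \<le> c" using that abs_Re_le_cmod[of z] abs_Im_le_cmod[of z] by linarith
    then show ?thesis using c[of z] by blast
  qed
  then show ?thesis by blast
qed

lemma in_coords_image: "z \<in> coords ` S \<longleftrightarrow> point z \<in> S"
  by (metis coords_point image_iff point_coords)

lemma excess_is_lattice_field:
  assumes "\<And>z. K \<le> \<bar>Re z\<bar> \<or> K \<le> \<bar>Im z\<bar> \<Longrightarrow> z \<notin> coords ` A \<and> z \<notin> coords ` B"
  shows "lattice_field K"
proof
  fix p q
  show "\<exists>x\<in>balanced_stars. \<exists>y\<in>balanced_stars. (field_at 1 p q, field_at (Complex 1 1) p q, field_at \<i> p q,
     field_at (- 1) p q, field_at (- Complex 1 1) p q, field_at (- \<i>) p q) = x - y"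
    by (rule excess_balanced)
  let ?z = "Complex p q"
  obtain r where r: "0 < r" "\<And>v d. v \<noteq> 0 \<Longrightarrow> norm v < r \<Longrightarrow> d \<in> compass \<Longrightarrow> excess d (?z + v) =
    (if \<exists>k>0. v = k *\<^sub>R d then excess d ?z else if \<exists>k>0. v = k *\<^sub>R (- d) then excess (- d) ?z else 0)"
    using excess_near[of ?z] by blast
  show "\<exists>r>0. \<forall>s t. \<bar>s\<bar> < r \<longrightarrow> \<bar>t\<bar> < r \<longrightarrow> (s, t) \<noteq> (0, 0) \<longrightarrow>
        (let e = (if t = 0 then if 0 < s then field_at 1 p q else field_at (- 1) p q else 0);
             ne = (if s = t then if 0 < s then field_at (Complex 1 1) p q else field_at (- Complex 1 1) p q else 0);
             n = (if s = 0 then if 0 < t then field_at \<i> p q else field_at (- \<i>) p q else 0)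
         in field_at 1 (p + s) (q + t) = e \<and> field_at (- 1) (p + s) (q + t) = e \<and>
            field_at (Complex 1 1) (p + s) (q + t) = ne \<and> field_at (- Complex 1 1) (p + s) (q + t) = ne \<and>
            field_at \<i> (p + s) (q + t) = n \<and> field_at (- \<i>) (p + s) (q + t) = n)"
  proof (intro exI[of _ "r / 2"] conjI allI impI)
    fix s t assume st: "\<bar>s\<bar> < r / 2" "\<bar>t\<bar> < r / 2" "(s, t) \<noteq> (0, 0)"
    have v: "Complex s t \<noteq> 0" "norm (Complex s t) < r"
      using st cmod_le[of "Complex s t"] by (auto simp: complex_eq_iff)
    have z: "Complex (p + s) (q + t) = ?z + Complex s t" by (simp add: complex_eq_iff)
    have neg: "- (- d) = d" for d :: complex by simp
    have at: "excess d (Complex (p + s) (q + t)) =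
      (if \<exists>k>0. Complex s t = k *\<^sub>R d then excess d ?z
       else if \<exists>k>0. Complex s t = k *\<^sub>R (- d) then excess (- d) ?z else 0)" if "d \<in> compass" for d
      unfolding z by (rule r(2)[OF v that])
    have in_c: "1 \<in> compass" "Complex 1 1 \<in> compass" "\<i> \<in> compass" "- 1 \<in> compass" "- Complex 1 1 \<in> compass"
      "- \<i> \<in> compass" by (auto simp: compass_def)
    note all = in_c[THEN at, unfolded neg compass_rays]
    show "let e = (if t = 0 then if 0 < s then field_at 1 p q else field_at (- 1) p q else 0);
             ne = (if s = t then if 0 < s then field_at (Complex 1 1) p q else field_at (- Complex 1 1) p q else 0);
             n = (if s = 0 then if 0 < t then field_at \<i> p q else field_at (- \<i>) p q else 0)
         in field_at 1 (p + s) (q + t) = e \<and> field_at (- 1) (p + s) (q + t) = e \<and>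
            field_at (Complex 1 1) (p + s) (q + t) = ne \<and> field_at (- Complex 1 1) (p + s) (q + t) = ne \<and>
            field_at \<i> (p + s) (q + t) = n \<and> field_at (- \<i>) (p + s) (q + t) = n"
      unfolding Let_def all using st(3) by (simp only: prod.inject) (smt (verit))
  qed (use r(1) in simp)
  assume "K \<le> \<bar>p\<bar> \<or> K \<le> \<bar>q\<bar>"
  then have "point ?z \<notin> A" "point ?z \<notin> B" using assms[of ?z] by (simp_all add: in_coords_image)
  then have "excess d ?z = 0" for d by (simp add: excess_def edge_at_def directions_outside)
  then show "field_at 1 p q = 0 \<and> field_at (Complex 1 1) p q = 0 \<and> field_at \<i> p q = 0 \<and>
     field_at (- 1) p q = 0 \<and> field_at (- Complex 1 1) p q = 0 \<and> field_at (- \<i>) p q = 0" by blast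
qed

text \<open>On the complement of \<open>B\<close>, which is connected, the plateau of the maximum would be open and closed,
  and neither empty nor everything.\<close>
lemma excess_stress_nonpositive:
  assumes out: "\<And>z. K \<le> \<bar>Re z\<bar> \<or> K \<le> \<bar>Im z\<bar> \<Longrightarrow> z \<notin> coords ` A \<and> z \<notin> coords ` B"
  shows "excess_stress p q \<le> 0"
proof (rule ccontr)
  interpret L: balanced_lattice_field "field_at 1" "field_at (Complex 1 1)" "field_at \<i>"
     "field_at (- 1)" "field_at (- Complex 1 1)" "field_at (- \<i>)" K
    using out by (rule excess_is_lattice_field)
  assume "\<not> excess_stress p q \<le> 0"
  then obtain p0 q0 where peak: "L.stress_peak p0 q0" "0 < L.stress p0 q0"
    using L.stress_peak_exists[of p q] by auto
  define M where "M = {z. L.stress (Re z) (Im z) = L.stress p0 q0}"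
  let ?C = "- coords ` B"
  note B = acyclic_network_nonseparating[OF segments(2) acyclic(2)]
  have "closed M"
    unfolding M_def by (rule closed_Collect_eq[OF L.stress_continuous continuous_on_const])
  have openC: "open ?C" using B(2) by (rule open_Compl)
  have "open (M \<inter> ?C)"
    unfolding open_contains_ball
  proof
    fix z assume z: "z \<in> M \<inter> ?C"
    have "L.stress_peak (Re z) (Im z)" using peak(1) z by (auto simp: L.stress_peak_def M_def)
    moreover have "directions B (point z) = {}" using z by (intro directions_outside) (auto simp: in_coords_image)
    then have "0 \<le> excess d z" for d by (simp add: excess_def edge_at_def)
    ultimately obtain r where r: "0 < r" "\<And>s t. \<bar>s\<bar> < r \<Longrightarrow> \<bar>t\<bar> < r \<Longrightarrow>
        L.stress (Re z + s) (Im z + t) = L.stress (Re z) (Im z)"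
      using L.stress_peak_flat_where_nonnegative[of "Re z" "Im z"] by (auto simp: complex_surj)
    obtain r' where r': "0 < r'" "ball z r' \<subseteq> ?C" using openC z by (meson IntD2 openE)
    have "y \<in> M" if y: "y \<in> ball z r" for y
    proof -
      have "\<bar>Re (y - z)\<bar> < r" "\<bar>Im (y - z)\<bar> < r"
        using y abs_Re_le_cmod[of "y - z"] abs_Im_le_cmod[of "y - z"] by (auto simp: dist_norm norm_minus_commute)
      then show ?thesis using r(2)[of "Re (y - z)" "Im (y - z)"] z by (simp add: M_def)
    qed
    then have "ball z (min r r') \<subseteq> M \<inter> ?C" using r'(2) by auto
    then show "\<exists>e>0. ball z e \<subseteq> M \<inter> ?C" using r(1) r'(1) by (intro exI[of _ "min r r'"]) auto
  qed
  moreover have "open (- M)" using \<open>closed M\<close> by (rule open_Compl)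
  moreover have "M \<inter> ?C \<noteq> {}"
  proof -
    obtain s t e where e: "0 < e" "\<And>s' t'. \<bar>s' - s\<bar> < e \<Longrightarrow> \<bar>t' - t\<bar> < e \<Longrightarrow> L.stress s' t' = L.stress p0 q0"
      using L.stress_peak_flat_sector[OF peak(1)] by blast
    have "ball (Complex s t) e \<subseteq> M"
    proof
      fix y assume "y \<in> ball (Complex s t) e"
      then have "\<bar>Re y - s\<bar> < e" "\<bar>Im y - t\<bar> < e"
        using abs_Re_le_cmod[of "y - Complex s t"] abs_Im_le_cmod[of "y - Complex s t"]
        by (auto simp: dist_norm norm_minus_commute)
      then show "y \<in> M" using e(2) by (simp add: M_def)
    qed
    moreover have "\<not> ball (Complex s t) e \<subseteq> coords ` B"
    proof
      assume "ball (Complex s t) e \<subseteq> coords ` B"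
      then have "ball (Complex s t) e \<subseteq> interior (coords ` B)" by (intro interior_maximal) auto
      then show False using B(3) e(1) by auto
    qed
    ultimately show ?thesis by blast
  qed
  moreover have "- M \<inter> ?C \<noteq> {}"
  proof -
    have "K \<le> \<bar>\<bar>K\<bar>\<bar>" by simp
    then have "Complex \<bar>K\<bar> 0 \<in> ?C" "L.stress \<bar>K\<bar> 0 = 0"
      using out[of "Complex \<bar>K\<bar> 0"] L.stress_outside_strip by auto
    then have "Complex \<bar>K\<bar> 0 \<in> - M \<inter> ?C" using peak(2) by (simp add: M_def)
    then show ?thesis by blast
  qed
  ultimately show False
    using connectedD[OF B(1), of "M \<inter> ?C" "- M"] by blast
qed

text \<open>Exchanging \<open>A\<close> and \<open>B\<close> changes the sign of the stress function, so the upper bound 0 is also a lower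
  bound.\<close>
lemma frame_direction_agrees: "e0 \<in> directions A x \<longleftrightarrow> e0 \<in> directions B x"
proof -
  interpret swapped: codirected_networks e0 e2 B A
  proof
    show "finite_union_of_segments B" "finite_union_of_segments A" "no_closed_loop B" "no_closed_loop A"
      using segments acyclic by blast+
    show "directions B x = directions A x \<or>
        balanced_directions (directions B x) \<and> balanced_directions (directions A x)" for x
      using local[of x] by metis
  qed
  obtain K where out: "\<And>z. K \<le> \<bar>Re z\<bar> \<or> K \<le> \<bar>Im z\<bar> \<Longrightarrow> z \<notin> coords ` A \<and> z \<notin> coords ` B"
    using bounding_box by blast
  interpret L: balanced_lattice_field "field_at 1" "field_at (Complex 1 1)" "field_at \<i>"
     "field_at (- 1)" "field_at (- Complex 1 1)" "field_at (- \<i>)" K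
    using out by (rule excess_is_lattice_field)
  interpret L': balanced_lattice_field "swapped.field_at 1" "swapped.field_at (Complex 1 1)" "swapped.field_at \<i>"
     "swapped.field_at (- 1)" "swapped.field_at (- Complex 1 1)" "swapped.field_at (- \<i>)" K
    using out by (intro swapped.excess_is_lattice_field) auto
  have neg: "swapped.excess d z = - excess d z" for d z
    by (simp add: excess_def swapped.excess_def)
  have "L'.stress p q = - L.stress p q" for p q
    unfolding L.stress_def L'.stress_def by (simp add: neg weighted_sum_uminus)
  moreover have "L.stress p q \<le> 0" "L'.stress p q \<le> 0" for p q
    using excess_stress_nonpositive[of K] swapped.excess_stress_nonpositive[of K] out by auto
  ultimately have "L.stress p q = 0" for p q by (metis antisym neg_le_0_iff_le)
  then have "excess 1 (coords x) = 0"
    using L.stress_zero_imp_field_zero[of "Re (coords x)" "Im (coords x)"] by simp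
  moreover have "point 1 = e0" by (simp add: point_def)
  ultimately show ?thesis by (auto simp: excess_def edge_at_def of_bool_def split: if_splits)
qed

end

lemma hexagonal_frame_exists:
  fixes u :: "real^2"
  assumes "norm u = 1"
  shows "\<exists>v. hexagonal_frame u v"
proof -
  define v :: "real^2" where "v = vector [- u $ 1 / 2 - sqrt 3 / 2 * u $ 2, - u $ 2 / 2 + sqrt 3 / 2 * u $ 1]"
  have u: "(u $ 1)\<^sup>2 + (u $ 2)\<^sup>2 = 1"
    using assms by (simp add: norm_eq_1 inner_vec_def sum_2 power2_eq_square)
  have s3: "sqrt 3 * (sqrt 3 * r) = 3 * r" for r :: real by (simp flip: mult.assoc)
  have "u \<bullet> v = - ((u $ 1)\<^sup>2 + (u $ 2)\<^sup>2) / 2"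
    by (simp add: v_def inner_vec_def sum_2 power2_eq_square algebra_simps add_divide_distrib)
  moreover have "v \<bullet> v = (u $ 1)\<^sup>2 + (u $ 2)\<^sup>2"
    by (simp add: v_def inner_vec_def sum_2 power2_eq_square algebra_simps add_divide_distrib s3)
  ultimately have "u \<bullet> v = - 1 / 2" "v \<bullet> v = 1" unfolding u by simp_all
  then show ?thesis using assms by (intro exI[of _ v] hexagonal_frame.intro) (simp_all add: norm_eq_1)
qed

theorem networks_same_directions:
  fixes A B :: "(real^2) set"
  assumes "finite_union_of_segments A" "finite_union_of_segments B" "no_closed_loop A" "no_closed_loop B"
    and "\<And>x. directions A x = directions B x \<or>
        balanced_directions (directions A x) \<and> balanced_directions (directions B x)"
  shows "directions A x = directions B x"
proof (rule set_eqI)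
  fix u
  show "u \<in> directions A x \<longleftrightarrow> u \<in> directions B x"
  proof (cases "norm u = 1")
    case True
    then obtain v where "hexagonal_frame u v" using hexagonal_frame_exists by blast
    then have "codirected_networks u v A B"
      using assms by (intro codirected_networks.intro codirected_networks_axioms.intro)
    then show ?thesis by (rule codirected_networks.frame_direction_agrees)
  qed (simp add: directions_def)
qed

section \<open>Topologies of codirected trees\<close>

lemma directions_local:
  fixes A B :: "'a::real_normed_vector set"
  assumes "A \<inter> ball x \<epsilon> = B \<inter> ball x \<epsilon>" "0 < \<epsilon>"
  shows "directions A x = directions B x"
proof -
  have sub: "directions A x \<subseteq> directions B x" if AB: "A \<inter> ball x \<epsilon> = B \<inter> ball x \<epsilon>" for A B
  proof
    fix u assume "u \<in> directions A x"
    then obtain t where u: "norm u = 1" "0 < t" "closed_segment x (x + t *\<^sub>R u) \<subseteq> A" by (auto simp: directions_def)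
    define s where "s = min t (\<epsilon> / 2)"
    have s: "0 < s" "s \<le> t" "s < \<epsilon>" using u(2) assms(2) by (auto simp: s_def)
    have "closed_segment x (x + s *\<^sub>R u) \<subseteq> closed_segment x (x + t *\<^sub>R u)"
    proof (rule closed_segment_subset)
      show "x + s *\<^sub>R u \<in> closed_segment x (x + t *\<^sub>R u)"
        unfolding closed_segment_def using s u(2)
        by (intro CollectI exI[of _ "s / t"]) (auto simp: algebra_simps)
    qed auto
    moreover have "closed_segment x (x + s *\<^sub>R u) \<subseteq> ball x \<epsilon>"
      by (rule closed_segment_subset) (use s u(1) assms(2) in \<open>auto simp: dist_norm\<close>)
    ultimately have "closed_segment x (x + s *\<^sub>R u) \<subseteq> B" using u(3) AB by blast
    then show "u \<in> directions B x" using u(1) s(1) by (auto simp: directions_def)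
  qed
  show ?thesis using sub[of A B] sub[of B A] assms(1) by auto
qed

text \<open>Every point of a nondegenerate segment in \<open>A\<close> has a direction in \<open>A\<close>, hence one in \<open>B\<close>, and so belongs to \<open>B\<close>.\<close>
lemma segment_transfer:
  fixes A B :: "'a::euclidean_space set"
  assumes "\<And>x. directions A x = directions B x" "a \<noteq> b" "closed_segment a b \<subseteq> A"
  shows "closed_segment a b \<subseteq> B"
proof
  fix y assume y: "y \<in> closed_segment a b"
  then obtain c where c: "c \<in> {a, b}" "c \<noteq> y" using assms(2) by blast
  have "closed_segment y (y + norm (c - y) *\<^sub>R sgn (c - y)) = closed_segment y c"
    using c(2) by (simp add: sgn_div_norm)
  also have "\<dots> \<subseteq> A" using y c(1) assms(3) closed_segment_subset[of y "closed_segment a b" c] by auto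
  finally have "sgn (c - y) \<in> directions A y"
    using c(2) unfolding directions_def by (intro CollectI conjI exI[of _ "norm (c - y)"]) (auto simp: norm_sgn)
  then show "y \<in> B" using assms(1) directions_outside[of y B] by auto
qed

text \<open>The graph of a tree only depends on its nondegenerate segments. The sets \<open>A\<close> and \<open>B\<close> need not be
  equal: without terminals they may be different single points.\<close>
lemma tree_graph_cong:
  assumes "\<And>x. directions A x = directions B x"
  shows "tree_graph xs A = tree_graph xs B"
proof -
  have seg: "closed_segment a b \<subseteq> A \<longleftrightarrow> closed_segment a b \<subseteq> B" if "a \<noteq> b" for a b
    using segment_transfer[of A B, OF assms that] segment_transfer[of B A, OF assms[symmetric] that] by blast
  define tripod where "tripod S x a b c \<longleftrightarrow> a \<noteq> x \<and> b \<noteq> x \<and> c \<noteq> x \<and>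
        closed_segment x a \<subseteq> S \<and> closed_segment x b \<subseteq> S \<and> closed_segment x c \<subseteq> S \<and>
        closed_segment x a \<inter> closed_segment x b = {x} \<and>
        closed_segment x a \<inter> closed_segment x c = {x} \<and>
        closed_segment x b \<inter> closed_segment x c = {x}" for S :: "(real^2) set" and x a b c
  have steiner: "steiner_points P S = {x. x \<notin> P \<and> (\<exists>a b c. tripod S x a b c)}" for P S
  proof -
    have "x \<in> S" if "tripod S x a b c" for x a b c
      using that ends_in_segment(1)[of x a] unfolding tripod_def by blast
    then show ?thesis unfolding steiner_points_def tripod_def[symmetric] by blast
  qed
  have "tripod A x a b c \<longleftrightarrow> tripod B x a b c" for x a b c
    unfolding tripod_def using seg[of x a] seg[of x b] seg[of x c] by argo
  then have "steiner_points (set xs) A = steiner_points (set xs) B" by (simp only: steiner)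
  then have V: "tree_vertices (set xs) A = tree_vertices (set xs) B" by (simp add: tree_vertices_def)
  show ?thesis unfolding tree_graph_def V Let_def using seg by (simp cong: conj_cong)
qed

lemma lgraph_iso_common_source:
  assumes "G \<cong>\<^sub>L T" "G \<cong>\<^sub>L T'" "set (terms G) \<subseteq> verts G"
  shows "T \<cong>\<^sub>L T'"
proof -
  obtain f where f: "bij_betw f (verts G) (verts T)"
    "\<And>u v. u \<in> verts G \<Longrightarrow> v \<in> verts G \<Longrightarrow> adj G u v \<longleftrightarrow> adj T (f u) (f v)" "map f (terms G) = terms T"
    using assms(1) unfolding lgraph_iso_def by blast
  obtain g where g: "bij_betw g (verts G) (verts T')"
    "\<And>u v. u \<in> verts G \<Longrightarrow> v \<in> verts G \<Longrightarrow> adj G u v \<longleftrightarrow> adj T' (g u) (g v)" "map g (terms G) = terms T'"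
    using assms(2) unfolding lgraph_iso_def by blast
  let ?h = "inv_into (verts G) f"
  have h: "bij_betw ?h (verts T) (verts G)" using f(1) by (rule bij_betw_inv_into)
  have fh: "f (?h u) = u" "?h u \<in> verts G" if "u \<in> verts T" for u
    using f(1) that by (auto simp: bij_betw_def f_inv_into_f inv_into_into)
  show ?thesis
    unfolding lgraph_iso_def
  proof (intro exI[of _ "g \<circ> ?h"] conjI ballI)
    show "bij_betw (g \<circ> ?h) (verts T) (verts T')" using h g(1) by (rule bij_betw_trans)
    fix u v assume uv: "u \<in> verts T" "v \<in> verts T"
    have "adj T u v \<longleftrightarrow> adj T (f (?h u)) (f (?h v))" using fh uv by simp
    also have "\<dots> \<longleftrightarrow> adj G (?h u) (?h v)" using f(2) fh uv by simp
    also have "\<dots> \<longleftrightarrow> adj T' (g (?h u)) (g (?h v))" using g(2) fh uv by simp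
    finally show "adj T u v \<longleftrightarrow> adj T' ((g \<circ> ?h) u) ((g \<circ> ?h) v)" by simp
  next
    have "map (g \<circ> ?h) (terms T) = map g (map (?h \<circ> f) (terms G))" by (simp flip: f(3))
    also have "map (?h \<circ> f) (terms G) = map id (terms G)"
      using f(1) assms(3) by (intro map_cong refl) (auto simp: bij_betw_def inv_into_f_f)
    finally have "map (g \<circ> ?h) (terms T) = map g (map id (terms G))" .
    then show "map (g \<circ> ?h) (terms T) = terms T'" using g(3) by simp
  qed
qed

theorem theorem1:
  "\<not> (\<exists>(xs :: (real^2) list) (T\<^sub>1 :: topology) (T\<^sub>2 :: topology) S\<^sub>1 S\<^sub>2.
        distinct xs \<and> \<not> T\<^sub>1 \<cong>\<^sub>L T\<^sub>2 \<and>
        locally_minimal_tree_of T\<^sub>1 xs S\<^sub>1 \<and>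
        locally_minimal_tree_of T\<^sub>2 xs S\<^sub>2 \<and>
        codirected_at (set xs) S\<^sub>1 S\<^sub>2)"
proof clarify
  fix xs :: "(real^2) list" and T\<^sub>1 T\<^sub>2 :: topology and S\<^sub>1 S\<^sub>2
  assume ne: "\<not> T\<^sub>1 \<cong>\<^sub>L T\<^sub>2" and T: "locally_minimal_tree_of T\<^sub>1 xs S\<^sub>1" "locally_minimal_tree_of T\<^sub>2 xs S\<^sub>2"
    and cod: "codirected_at (set xs) S\<^sub>1 S\<^sub>2"
  have lmt: "locally_minimal_tree (set xs) S\<^sub>1" "locally_minimal_tree (set xs) S\<^sub>2"
    using T by (simp_all add: locally_minimal_tree_of_def)
  obtain \<epsilon> where \<epsilon>: "0 < \<epsilon>" "S\<^sub>1 \<inter> (\<Union>p\<in>set xs. ball p \<epsilon>) = S\<^sub>2 \<inter> (\<Union>p\<in>set xs. ball p \<epsilon>)"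
    using cod by (auto simp: codirected_at_def)
  have "directions S\<^sub>1 x = directions S\<^sub>2 x" for x
  proof (rule networks_same_directions)
    fix x
    show "directions S\<^sub>1 x = directions S\<^sub>2 x \<or>
        balanced_directions (directions S\<^sub>1 x) \<and> balanced_directions (directions S\<^sub>2 x)"
    proof (cases "x \<in> set xs")
      case True
      then have "S\<^sub>1 \<inter> ball x \<epsilon> = S\<^sub>2 \<inter> ball x \<epsilon>" using \<epsilon>(2) by blast
      then show ?thesis using directions_local \<epsilon>(1) by blast
    next
      case False
      then show ?thesis using locally_minimal_tree_balanced lmt by blast
    qed
  qed (use lmt in \<open>auto simp: locally_minimal_tree_def\<close>)
  then have "tree_graph xs S\<^sub>1 = tree_graph xs S\<^sub>2" by (rule tree_graph_cong)
  moreover have "set (terms (tree_graph xs S\<^sub>1)) \<subseteq> verts (tree_graph xs S\<^sub>1)"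
    by (simp add: tree_graph_def Let_def tree_vertices_def)
  ultimately have "T\<^sub>1 \<cong>\<^sub>L T\<^sub>2"
    using T lgraph_iso_common_source unfolding locally_minimal_tree_of_def by metis
  then show False using ne by contradiction
qed

end
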